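(* Let $p,q\in(1,\infty)$, let $K_q\in(1,\infty)$ be a constant, and let $f,g$ be nonnegative Borel functions on $\Omega$. Then there exists a constant $K_p=K(p,q,K_q,N_0)\ge 1$ (depending only on $p,q,K_q,N_0$, and not on $f,g$) such that if $$\int_{\Omega} f^{p}\,w_p\,\mu(dx)\le \int_{\Omega} g^{p}\,w_p\,\mu(dx)$$ for every $w_p\in A_p$ with $[w_p]_{A_p}\le K_p$, then $$\int_{\Omega} f^{q}\,w_q\,\mu(dx)\le 4^{q}\int_{\Omega} g^{q}\,w_q\,\mu(dx)$$ for every $w_q\in A_q$ with $[w_q]_{A_q}\le K_q$.
   Context: Fix integers $d\ge1$ and $k_1,\dots,k_d\ge 1$. Let $\Omega=I_1\times\dots\times I_d\subset\mathbb{R}^d$, where each $I_j$ is either $\mathbb{R}$ or a shifted half-line $[a_j,\infty)$. For $x\in\Omega$, $l>0$ put $$C_{l,x}=x+[0,l^{k_1})\times\dots\times[0,l^{k_d}),\qquad C_l(x)=x+(-l^{k_1}/2,l^{k_1}/2)\times\dots\times(-l^{k_d}/2,l^{k_d}/2).$$ Let $\mathbb{Q}$ be the collection of all $C_l(x)$, $x\in\Omega$, $l>0$, that lie entirely in $\Omega$. $\mu$ is a measure on the Borel subsets of $\Omega$, finite on every $C_{l,x}$, such that: (1) $\lim_{l\to\infty}\mu(C_{l,x})=\infty$ for every $x\in\Omega$; (2) $\mu(\partial\Omega)=0$; (3) $\mu(C_{4l}(x)\cap\Omega)\le N_0\,\mu(C_l(x))$ for every $C_l(x)\in\mathbb{Q}$,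 where $N_0$ is a constant. For a Borel set $A$, $f_A=\frac1{\mu(A)}\int_A f\,\mu(dx)$. Weights: let $w$ be a measurable function on $\Omega$ with $0<w<\infty$ $\mu$-a.e. and $w_Q<\infty$ for every $Q\in\mathbb{Q}$. For $p\in(1,\infty)$, $w$ is an $A_p$-weight ($w\in A_p$) if there is a constant $N$ with $w_Q\big((w^{-1/(p-1)})_Q\big)^{p-1}\le N$ for all $Q\in\mathbb{Q}$; the least such $N$ is denoted $[w]_{A_p}$. *)

theory Defs
  imports "HOL-Analysis.Analysis"
begin

text \<open>The dimension \<open>d\<close> is a natural number rather than a type because the constant of the theorem
  must not depend on it. Points of the \<open>d\<close>-dimensional space are sequences vanishing from index
  \<open>d\<close> on, as in \<^const>\<open>Euclidean_space\<close>; coordinates are numbered from 0.\<close>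

definition domain :: "nat \<Rightarrow> (nat \<Rightarrow> real set) \<Rightarrow> (nat \<Rightarrow> real) set" where
  "domain d I = {x \<in> topspace (Euclidean_space d). \<forall>j<d. x j \<in> I j}"

definition corner_box :: "nat \<Rightarrow> (nat \<Rightarrow> nat) \<Rightarrow> real \<Rightarrow> (nat \<Rightarrow> real) \<Rightarrow> (nat \<Rightarrow> real) set" where
  "corner_box d k l x =
     {y \<in> topspace (Euclidean_space d). \<forall>j<d. y j \<in> {x j ..< x j + l ^ k j}}"

definition centered_box :: "nat \<Rightarrow> (nat \<Rightarrow> nat) \<Rightarrow> real \<Rightarrow> (nat \<Rightarrow> real) \<Rightarrow> (nat \<Rightarrow> real) set" where
  "centered_box d k l x =
     {y \<in> topspace (Euclidean_space d). \<forall>j<d. y j \<in> {x j - l ^ k j / 2 <..< x j + l ^ k j / 2}}"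

definition boxes :: "nat \<Rightarrow> (nat \<Rightarrow> nat) \<Rightarrow> (nat \<Rightarrow> real set) \<Rightarrow> (nat \<Rightarrow> real) set set" where
  "boxes d k I = {centered_box d k l x | l x.
     x \<in> domain d I \<and> 0 < l \<and> centered_box d k l x \<subseteq> domain d I}"

text \<open>\<^term>\<open>borel :: (nat \<Rightarrow> real) measure\<close> refers to the product topology, so its restriction to the
  domain is the Borel sigma-algebra of the domain. The boundary is taken in the
  \<open>d\<close>-dimensional space, not in the ambient sequence space.\<close>

definition doubling_space ::
  "nat \<Rightarrow> (nat \<Rightarrow> nat) \<Rightarrow> (nat \<Rightarrow> real set) \<Rightarrow> (nat \<Rightarrow> real) measure \<Rightarrow> real \<Rightarrow> bool" where
  "doubling_space d k I M N\<^sub>0 \<longleftrightarrow>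
     1 \<le> d \<and> (\<forall>j<d. 1 \<le> k j) \<and> (\<forall>j<d. I j = UNIV \<or> (\<exists>a. I j = {a..})) \<and>
     sets M = sets (restrict_space borel (domain d I)) \<and>
     (\<forall>x\<in>domain d I. \<forall>l>0. emeasure M (corner_box d k l x) < \<infinity>) \<and>
     (\<forall>x\<in>domain d I. ((\<lambda>l. emeasure M (corner_box d k l x)) \<longlongrightarrow> \<infinity>) at_top) \<and>
     emeasure M (Euclidean_space d frontier_of domain d I) = 0 \<and>
     (\<forall>x\<in>domain d I. \<forall>l>0. centered_box d k l x \<in> boxes d k I \<longrightarrow>
        emeasure M (centered_box d k (4 * l) x \<inter> domain d I)
          \<le> ennreal N\<^sub>0 * emeasure M (centered_box d k l x))"

text \<open>Real powers on \<open>[0, \<infinity>]\<close>, with the usual conventions at the end points.\<close>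

definition ennreal_powr :: "ennreal \<Rightarrow> real \<Rightarrow> ennreal" where
  "ennreal_powr x a =
     (if a = 0 then 1
      else if x = 0 then (if 0 < a then 0 else \<infinity>)
      else if x = \<infinity> then (if 0 < a then \<infinity> else 0)
      else ennreal (enn2real x powr a))"

definition average :: "'a measure \<Rightarrow> 'a set \<Rightarrow> ('a \<Rightarrow> ennreal) \<Rightarrow> ennreal" where
  "average M A f = (\<integral>\<^sup>+x\<in>A. f x \<partial>M) / emeasure M A"

definition weight :: "'a measure \<Rightarrow> 'a set set \<Rightarrow> ('a \<Rightarrow> ennreal) \<Rightarrow> bool" where
  "weight M \<Q> w \<longleftrightarrow> w \<in> borel_measurable M \<and> (AE x in M. 0 < w x \<and> w x < \<infinity>) \<and>
     (\<forall>Q\<in>\<Q>. average M Q w < \<infinity>)"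

definition Ap_bound :: "'a measure \<Rightarrow> 'a set set \<Rightarrow> real \<Rightarrow> ('a \<Rightarrow> ennreal) \<Rightarrow> real \<Rightarrow> bool" where
  "Ap_bound M \<Q> p w N \<longleftrightarrow>
     (\<forall>Q\<in>\<Q>. average M Q w *
        ennreal_powr (average M Q (\<lambda>x. ennreal_powr (w x) (- 1 / (p - 1)))) (p - 1) \<le> ennreal N)"

definition Ap_weights :: "'a measure \<Rightarrow> 'a set set \<Rightarrow> real \<Rightarrow> ('a \<Rightarrow> ennreal) set" where
  "Ap_weights M \<Q> p = {w. weight M \<Q> w \<and> (\<exists>N. Ap_bound M \<Q> p w N)}"

text \<open>Although \<^term>\<open>ennreal N = 0\<close> for negative \<open>N\<close>, no negative \<open>N\<close> is an \<^const>\<open>Ap_bound\<close> on a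
  \<^const>\<open>doubling_space\<close>: there each box has positive finite measure, so the bounded product is
  positive. Hence the least bound exists for every weight in \<^const>\<open>Ap_weights\<close>.\<close>

definition Ap_const :: "'a measure \<Rightarrow> 'a set set \<Rightarrow> real \<Rightarrow> ('a \<Rightarrow> ennreal) \<Rightarrow> real" where
  "Ap_const M \<Q> p w = (LEAST N. Ap_bound M \<Q> p w N)"

end

theory Submission
  imports Defs
begin

text \<open>Rubio de Francia's extrapolation. For an A_q-weight \<open>w\<close> with dual weight \<open>s\<close> the uncentred maximal
  operator is bounded on \<open>L_q(w)\<close> and on \<open>L_q'(s)\<close>. Iterating it, one majorises \<open>g\<close> by an A_1-weight
  \<open>G\<close> and \<open>f powe (q - 1) * w\<close> by an A_1-weight \<open>V\<close>, each at the cost of a factor 2 in norm. Then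
  \<open>G powe (1 - p) * V\<close> is an A_p-weight with controlled constant, and applying the hypothesis to it
  together with Hoelder's inequality for \<open>f * V\<close> and for \<open>G * V\<close> gives the factor \<open>2 * 2 = 4\<close>.

  All constants depend on the space only through the doubling constant because the boundedness of
  the maximal operator uses only a Vitali covering argument: a box, enlarged four times and then
  translated into the domain, swallows every smaller box of the family that meets it.\<close>

section \<open>Powers of extended nonnegative reals\<close>

text \<open>The choice of \<open>f powe (q - 1) * w\<close> is duality: with
  \<open>q' = q / (q - 1)\<close>, its integral against \<open>f\<close> and the integral of its
  \<open>q'\<close>-th power against \<open>s\<close> both equal the integral J of
  \<open>f powe q * w\<close>. With L the corresponding integral for \<open>g\<close>, the Hoelder
  estimates give \<open>J \<le> 4 * L powe (1 / q) * J powe (1 - 1 / q)\<close>, from which a power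
  of J has to be cancelled. This cancellation, and the positivity and finiteness of the two
  majorants, require that J and L be finite and that neither function vanish almost everywhere.
  Hence the truncation of \<open>f\<close> and the separate case of vanishing \<open>g\<close>.

  Integrals and averages live in \<open>ennreal\<close>, where they always exist. The price is that
  \<open>0 * top = 0\<close> spoils some laws of powers at the two end points, so negative exponents
  are handled only where the base is positive and finite, which for weights means almost
  everywhere.\<close>

notation ennreal_powr (infixr "powe" 80)

lemma ennreal_cases_pos [case_names zero top pos]:
  fixes x :: ennreal
  obtains "x = 0" | "x = top" | r where "0 < r" "x = ennreal r"
proof (cases x)
  case (real r)
  then show ?thesis using that by (cases "r = 0") auto
qed (use that in auto)

lemma mult_divide_cancel_ennreal:
  fixes a c :: ennreal
  assumes "0 < c" "c < top" shows "c * (a / c) = a"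
  using assms mult_divide_eq_ennreal[of c a] by (auto simp: ennreal_times_divide mult.commute)

lemma powe_ennreal: "0 < r \<Longrightarrow> ennreal r powe a = ennreal (r powr a)"
  by (auto simp: ennreal_powr_def)

lemma powe_ennreal_nonneg: "0 \<le> r \<Longrightarrow> 0 < a \<Longrightarrow> ennreal r powe a = ennreal (r powr a)"
  by (auto simp: ennreal_powr_def)

lemma powe_zero [simp]: "0 < a \<Longrightarrow> 0 powe a = 0" "a < 0 \<Longrightarrow> 0 powe a = top"
  by (auto simp: ennreal_powr_def)

lemma powe_top [simp]: "0 < a \<Longrightarrow> top powe a = top" "a < 0 \<Longrightarrow> top powe a = 0"
  by (auto simp: ennreal_powr_def)

lemma powe_0_right [simp]: "x powe 0 = 1"
  by (auto simp: ennreal_powr_def)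

lemma powe_1_left [simp]: "1 powe a = 1"
  by (auto simp: ennreal_powr_def)

lemma powe_1_right [simp]: "x powe 1 = x"
  by (cases x rule: ennreal_cases_pos) (auto simp: powe_ennreal)

text \<open>At 0 and \<open>top\<close> only the sign of the exponent matters, and signs multiply
  like the exponents; so the law holds without side conditions.\<close>

lemma powe_powe: "(x powe a) powe b = x powe (a * b)"
  by (cases x rule: ennreal_cases_pos; cases a "0::real" rule: linorder_cases;
      cases b "0::real" rule: linorder_cases)
    (auto simp: powe_ennreal powr_powr mult_neg_neg mult_pos_neg mult_neg_pos)

text \<open>For negative \<open>a\<close> the law fails at \<open>x = 0\<close>,
  \<open>y = top\<close>: there the left side is \<open>top\<close> and the right side is 0.
  \<open>powe_mult_pos\<close> covers negative exponents.\<close>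

lemma powe_mult:
  assumes "0 \<le> a" shows "(x * y) powe a = x powe a * y powe a"
proof (cases "a = 0")
  case False
  with assms have "0 < a" by simp
  then show ?thesis
    by (cases x rule: ennreal_cases_pos; cases y rule: ennreal_cases_pos)
      (auto simp: powe_ennreal powr_mult ennreal_top_mult ennreal_mult_top simp flip: ennreal_mult)
qed simp

lemma powe_mult_pos:
  "0 < x \<and> x < top \<Longrightarrow> 0 < y \<and> y < top \<Longrightarrow> (x * y) powe a = x powe a * y powe a"
  by (cases x rule: ennreal_cases_pos; cases y rule: ennreal_cases_pos)
    (auto simp: powe_ennreal powr_mult simp flip: ennreal_mult)

text \<open>Exponents of opposite signs fail at the end points:
  \<open>0 powe 1 * 0 powe (- 1)\<close> is 0, whereas \<open>0 powe 0\<close> is 1.\<close>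

lemma powe_add:
  assumes "(0 < x \<and> x < top) \<or> (0 \<le> a \<and> 0 \<le> b)"
  shows "x powe (a + b) = x powe a * x powe b"
proof (cases x rule: ennreal_cases_pos)
  case pos
  then show ?thesis by (auto simp: powe_ennreal powr_add simp flip: ennreal_mult)
next
  case zero
  with assms show ?thesis by (cases "a = 0"; cases "b = 0") auto
next
  case top
  with assms show ?thesis by (cases "a = 0"; cases "b = 0") (auto simp: ennreal_top_mult)
qed

lemma powe_mono:
  assumes "0 \<le> a" "x \<le> y" shows "x powe a \<le> y powe a"
proof (cases "a = 0")
  case False
  with assms show ?thesis
    by (cases x rule: ennreal_cases_pos; cases y rule: ennreal_cases_pos)
      (auto simp: powe_ennreal powr_mono2 top_unique ennreal_le_iff)
qed simp

lemma powe_antimono: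
  assumes "a \<le> 0" "x \<le> y" shows "y powe a \<le> x powe a"
proof (cases "a = 0")
  case False
  with assms show ?thesis
    by (cases x rule: ennreal_cases_pos; cases y rule: ennreal_cases_pos)
      (auto simp: powe_ennreal powr_mono2' top_unique ennreal_le_iff)
qed simp

lemma powe_pos_finite: "0 < x \<Longrightarrow> x < top \<Longrightarrow> 0 < x powe a \<and> x powe a < top"
  by (cases x rule: ennreal_cases_pos) (auto simp: powe_ennreal)

lemma powe_eq_0_iff: "0 < a \<Longrightarrow> x powe a = 0 \<longleftrightarrow> x = 0"
  by (cases x rule: ennreal_cases_pos) (auto simp: powe_ennreal)

lemma powe_less_top_iff: "0 < a \<Longrightarrow> x powe a < top \<longleftrightarrow> x < top"
  by (cases x rule: ennreal_cases_pos) (auto simp: powe_ennreal)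

lemma powe_measurable [measurable]:
  assumes [measurable]: "f \<in> borel_measurable M"
  shows "(\<lambda>x. f x powe a) \<in> borel_measurable M"
  unfolding ennreal_powr_def by measurable

section \<open>Young's and Hoelder's inequalities for extended reals\<close>

lemma powe_Young:
  fixes x y :: ennreal
  assumes "0 < t" "t < 1"
  shows "x powe t * y powe (1 - t) \<le> ennreal t * x + ennreal (1 - t) * y"
proof (cases x rule: ennreal_cases_pos)
  case xpos: (pos r)
  show ?thesis
  proof (cases y rule: ennreal_cases_pos)
    case (pos s)
    have "r powr t * s powr (1 - t) \<le> t * r + (1 - t) * s"
      using Youngs_inequality_0[of t "1 - t" r s] assms xpos pos by simp
    then show ?thesis using xpos pos assms
      by (simp add: powe_ennreal ennreal_leI flip: ennreal_mult ennreal_plus)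
  qed (use xpos assms in \<open>auto simp: ennreal_mult_top\<close>)
qed (use assms in \<open>auto simp: ennreal_mult_top\<close>)

text \<open>Young's inequality is integrated after dividing \<open>u\<close> and \<open>v\<close> by
  their integrals. The division makes sense only if both integrals are positive and finite. In the
  degenerate cases either the integrand vanishes almost everywhere or the right side is
  \<open>top\<close>.\<close>

lemma nn_integral_Hoelder:
  assumes [measurable]: "u \<in> borel_measurable M" "v \<in> borel_measurable M"
    and t: "0 < t" "t < 1"
  shows "(\<integral>\<^sup>+x. u x powe t * v x powe (1 - t) \<partial>M)
    \<le> (\<integral>\<^sup>+x. u x \<partial>M) powe t * (\<integral>\<^sup>+x. v x \<partial>M) powe (1 - t)"
proof -
  define A B where "A = (\<integral>\<^sup>+x. u x \<partial>M)" and "B = (\<integral>\<^sup>+x. v x \<partial>M)"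
  have "A = 0 \<or> B = 0 \<or> A = top \<and> B \<noteq> 0 \<or> B = top \<and> A \<noteq> 0 \<or> (0 < A \<and> A < top \<and> 0 < B \<and> B < top)"
    by (auto simp: zero_less_iff_neq_zero less_top)
  then show ?thesis unfolding A_def[symmetric] B_def[symmetric]
  proof (elim disjE)
    assume "A = 0"
    then have "AE x in M. u x = 0" by (simp add: A_def nn_integral_0_iff_AE)
    then have "(\<integral>\<^sup>+x. u x powe t * v x powe (1 - t) \<partial>M) = 0"
      using t by (subst nn_integral_0_iff_AE) auto
    then show "(\<integral>\<^sup>+x. u x powe t * v x powe (1 - t) \<partial>M) \<le> A powe t * B powe (1 - t)" by simp
  next
    assume "B = 0"
    then have "AE x in M. v x = 0" by (simp add: B_def nn_integral_0_iff_AE)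
    then have "(\<integral>\<^sup>+x. u x powe t * v x powe (1 - t) \<partial>M) = 0"
      using t by (subst nn_integral_0_iff_AE) auto
    then show "(\<integral>\<^sup>+x. u x powe t * v x powe (1 - t) \<partial>M) \<le> A powe t * B powe (1 - t)" by simp
  next
    assume "A = top \<and> B \<noteq> 0"
    then show "(\<integral>\<^sup>+x. u x powe t * v x powe (1 - t) \<partial>M) \<le> A powe t * B powe (1 - t)"
      using t by (simp add: powe_eq_0_iff)
  next
    assume "B = top \<and> A \<noteq> 0"
    then show "(\<integral>\<^sup>+x. u x powe t * v x powe (1 - t) \<partial>M) \<le> A powe t * B powe (1 - t)"
      using t by (simp add: powe_eq_0_iff)
  next
    assume AB: "0 < A \<and> A < top \<and> 0 < B \<and> B < top"
    define c where "c = A powe t * B powe (1 - t)"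
    have "u x powe t * v x powe (1 - t)
        \<le> c * (ennreal t * (u x / A) + ennreal (1 - t) * (v x / B))" for x
    proof -
      have *: "u x = A * (u x / A)" "v x = B * (v x / B)"
        using AB by (simp_all add: mult_divide_cancel_ennreal)
      have "u x powe t * v x powe (1 - t) = c * ((u x / A) powe t * (v x / B) powe (1 - t))"
        using t by (subst *(1), subst *(2), subst (1 2) powe_mult) (auto simp: c_def mult_ac)
      also have "\<dots> \<le> c * (ennreal t * (u x / A) + ennreal (1 - t) * (v x / B))"
        by (intro mult_left_mono powe_Young t) auto
      finally show ?thesis .
    qed
    then have "(\<integral>\<^sup>+x. u x powe t * v x powe (1 - t) \<partial>M)
        \<le> (\<integral>\<^sup>+x. c * (ennreal t * (u x / A) + ennreal (1 - t) * (v x / B)) \<partial>M)"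
      by (rule nn_integral_mono)
    also have "\<dots> = c * (ennreal t * (A / A) + ennreal (1 - t) * (B / B))"
      by (simp add: nn_integral_cmult nn_integral_add nn_integral_divide A_def B_def)
    also have "\<dots> = c"
    proof -
      have "A / A = 1" "B / B = 1" using AB by auto
      then show ?thesis using t by (simp add: ennreal_plus[symmetric] del: ennreal_plus)
    qed
    finally show "(\<integral>\<^sup>+x. u x powe t * v x powe (1 - t) \<partial>M) \<le> A powe t * B powe (1 - t)"
      by (simp add: c_def)
  qed
qed

text \<open>Sums over dyadic levels replace the Fubini argument in the Marcinkiewicz interpolation, so that
  no sigma-finiteness is needed.\<close>

lemma two_powr_between:
  fixes r :: real assumes "0 < r"
  obtains n :: int where "2 powr n < r" "r \<le> 2 powr (n + 1)"
proof
  define n where "n = \<lceil>log 2 r\<rceil> - 1"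
  have "n < log 2 r" "log 2 r \<le> n + 1" unfolding n_def by linarith+
  then show "2 powr n < r" "r \<le> 2 powr (n + 1)"
    using assms by (simp_all add: less_log_iff log_le_iff)
qed

lemma eq_top_if_ge_nat: "(\<And>m::nat. ennreal (real m) \<le> S) \<Longrightarrow> S = top"
  by (metis antisym_conv1 ennreal_Ex_less_of_nat ennreal_of_nat_eq_real_of_nat
      linorder_not_le top_greatest)

text \<open>A single layer suffices for finite \<open>x\<close>: if
  \<open>2 powr n < x \<le> 2 powr (n + 1)\<close>, then layer \<open>n - 1\<close> is present, and
  going from it to the upper end costs two dyadic steps, hence \<open>4 powr p\<close>. The factor 2
  in the layer condition matches \<open>weak_type_truncated\<close>.\<close>

lemma powe_le_layers:
  fixes x :: ennreal
  assumes "0 < p"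
  shows "x powe p \<le> ennreal (4 powr p) *
    (\<integral>\<^sup>+n. ennreal (2 powr (of_int n * p)) * indicator {y. 2 * ennreal (2 powr of_int n) < y} x
      \<partial>count_space (UNIV::int set))"
    (is "_ \<le> _ * ?S")
proof (cases x rule: ennreal_cases_pos)
  case zero
  with assms show ?thesis by simp
next
  have term_le: "ennreal (2 powr (of_int n * p)) \<le> ?S" if "2 * ennreal (2 powr of_int n) < x" for n :: int
    using nn_integral_ge_point[of n UNIV "\<lambda>n. ennreal (2 powr (of_int n * p)) * indicator {y. 2 * ennreal (2 powr of_int n) < y} x"] that
    by simp
  {
    case (pos r)
    obtain n :: int where n: "2 powr n < r" "r \<le> 2 powr (n + 1)"
      using two_powr_between pos by blast
    have "x powe p \<le> ennreal ((2 powr (n + 1)) powr p)"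
      using n pos assms by (auto simp: powe_ennreal intro!: ennreal_leI powr_mono2)
    also have "\<dots> = ennreal (4 powr p) * ennreal (2 powr (of_int (n - 1) * p))"
    proof -
      have "(4::real) powr p = 2 powr (2 * p)" by (subst powr_powr[symmetric]) simp
      then show ?thesis
        by (subst ennreal_mult[symmetric]) (simp_all add: powr_powr powr_add[symmetric] algebra_simps)
    qed
    also have "\<dots> \<le> ennreal (4 powr p) * ?S"
    proof (intro mult_left_mono term_le)
      have "2 * 2 powr of_int (n - 1) = (2::real) powr n" by (simp add: powr_diff)
      with n show "2 * ennreal (2 powr of_int (n - 1)) < x"
        using pos by (simp add: numeral_mult_ennreal ennreal_less_iff)
    qed simp
    finally show ?thesis .
  next
    case top
    have "ennreal (real m) \<le> ?S" for m :: nat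
    proof -
      \<comment> \<open>Chosen so that the single layer \<open>n\<close> already contributes at
        least \<open>2 powr m\<close>, which is at least \<open>m\<close>.\<close>
      define n :: int where "n = \<lceil>real m / p\<rceil>"
      have "real m / p \<le> of_int n" unfolding n_def by linarith
      then have "real m \<le> of_int n * p" using assms by (simp add: field_simps)
      have "real m \<le> 2 ^ m" by (simp add: of_nat_less_two_power order_less_imp_le)
      also have "\<dots> = 2 powr real m" by (simp add: powr_realpow)
      also have "\<dots> \<le> 2 powr (of_int n * p)" using \<open>real m \<le> of_int n * p\<close> by simp
      finally have "ennreal (real m) \<le> ennreal (2 powr (of_int n * p))" by (rule ennreal_leI)
      also have "\<dots> \<le> ?S" using top by (intro term_le) (simp add: ennreal_mult_less_top)
      finally show ?thesis .
    qed
    then have "?S = top"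
      by (rule eq_top_if_ge_nat)
    then show ?thesis by (simp add: ennreal_mult_top)
  }
qed

text \<open>The layers present are those up to a highest one, which contributes at most
  \<open>y powe a\<close>; below it the contributions decay geometrically with ratio
  \<open>2 powr - a\<close>.\<close>

lemma layers_le_powe:
  fixes y :: ennreal
  assumes "0 < a"
  shows "(\<integral>\<^sup>+n. ennreal (2 powr (of_int n * a)) * indicator {z. ennreal (2 powr of_int n) < z} y
      \<partial>count_space (UNIV::int set)) \<le> ennreal (1 / (1 - 2 powr - a)) * y powe a"
    (is "(\<integral>\<^sup>+n. ?F n \<partial>_) \<le> _")
proof (cases y rule: ennreal_cases_pos)
  case zero
  then show ?thesis by simp
next
  case top
  have "2 powr - a < (1::real)" using assms by (simp add: powr_less_one)
  then show ?thesis using top assms by (simp add: ennreal_mult_top)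
next
  case (pos r)
  obtain m :: int where m: "2 powr m < r" "r \<le> 2 powr (m + 1)"
    using two_powr_between pos by blast
  define q :: real where "q = 2 powr - a"
  have q: "0 < q" "q < 1" using assms by (simp_all add: q_def powr_less_one)
  \<comment> \<open>Levels are renumbered by their distance \<open>j\<close> below the highest level
    \<open>m\<close>, turning the sum into a geometric series.\<close>
  have bij: "bij_betw (\<lambda>j::nat. m - int j) UNIV {..m}"
    by (rule bij_betwI[where g = "\<lambda>n. nat (m - n)"]) auto
  have zero: "?F n = 0" if "n \<notin> {..m}" for n
  proof -
    have "r \<le> 2 powr (m + 1)" by fact
    also have "\<dots> \<le> 2 powr n" using that by simp
    finally show ?thesis using pos by (simp add: indicator_def ennreal_less_iff)
  qed
  have "(\<integral>\<^sup>+n. ?F n \<partial>count_space UNIV) = (\<integral>\<^sup>+n. ?F n * indicator {..m} n \<partial>count_space UNIV)"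
    using zero by (intro nn_integral_cong) (auto simp: indicator_def)
  also have "\<dots> = (\<integral>\<^sup>+n. ?F n \<partial>count_space {..m})"
    by (simp add: nn_integral_count_space_indicator)
  also have "\<dots> = (\<integral>\<^sup>+j. ?F (m - int j) \<partial>count_space UNIV)"
    by (rule nn_integral_bij_count_space[OF bij, symmetric])
  also have "\<dots> \<le> (\<integral>\<^sup>+j. y powe a * ennreal (q ^ j) \<partial>count_space UNIV)"
  proof (intro nn_integral_mono)
    fix j :: nat
    have "2 powr (of_int (m - int j) * a) = (2 powr m) powr a * q powr j"
      by (simp add: q_def powr_powr powr_add[symmetric] algebra_simps)
    also have "\<dots> \<le> r powr a * q ^ j"
      using m q assms by (intro mult_mono powr_mono2) (auto simp: powr_realpow)
    finally have "ennreal (2 powr (of_int (m - int j) * a)) \<le> y powe a * ennreal (q ^ j)"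
      using pos q by (simp add: powe_ennreal ennreal_leI flip: ennreal_mult)
    then show "?F (m - int j) \<le> y powe a * ennreal (q ^ j)"
      by (auto simp: indicator_def)
  qed
  also have "\<dots> = y powe a * (\<Sum>j. ennreal (q ^ j))"
    by (simp add: nn_integral_cmult nn_integral_count_space_nat)
  also have "(\<Sum>j. ennreal (q ^ j)) = ennreal (1 / (1 - q))"
    using q by (subst suminf_ennreal2) (auto simp: suminf_geometric summable_geometric)
  finally show ?thesis by (simp add: q_def mult.commute)
qed

section \<open>Maximal functions over a Vitali family\<close>

text \<open>At a point that lies in no member of the family the supremum is over the empty set,
  hence 0.\<close>

definition maximal :: "'a measure \<Rightarrow> 'a set set \<Rightarrow> ('a \<Rightarrow> ennreal) \<Rightarrow> 'a \<Rightarrow> ennreal" where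
  "maximal M \<Q> f x = (SUP Q\<in>{Q\<in>\<Q>. x \<in> Q}. average M Q f)"

lemma average_le_maximal: "Q \<in> \<Q> \<Longrightarrow> x \<in> Q \<Longrightarrow> average M Q f \<le> maximal M \<Q> f x"
  unfolding maximal_def by (rule SUP_upper) auto

lemma maximal_least:
  "(\<And>Q. Q \<in> \<Q> \<Longrightarrow> x \<in> Q \<Longrightarrow> average M Q f \<le> c) \<Longrightarrow> maximal M \<Q> f x \<le> c"
  unfolding maximal_def by (rule SUP_least) auto

text \<open>\<open>sz\<close> is kept apart from the measure so that the same sets and sizes can be
  reused with the measures having densities \<open>w\<close> and \<open>s\<close>; only
  \<open>N\<close> then changes. \<open>Lindeloef\<close> takes the place of a topology.\<close>

locale vitali_family =
  fixes M :: "'a measure" and \<Q> :: "'a set set" and sz :: "'a set \<Rightarrow> real" and N :: ennreal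
  assumes Q_sets [measurable]: "Q \<in> \<Q> \<Longrightarrow> Q \<in> sets M"
    and Q_pos: "Q \<in> \<Q> \<Longrightarrow> 0 < emeasure M Q"
    and Q_finite: "Q \<in> \<Q> \<Longrightarrow> emeasure M Q < top"
    and enlarge: "Q \<in> \<Q> \<Longrightarrow> \<exists>Q'\<in>\<Q>. Q \<subseteq> Q' \<and> emeasure M Q' \<le> N * emeasure M Q \<and>
      (\<forall>R\<in>\<Q>. R \<inter> Q \<noteq> {} \<longrightarrow> sz R \<le> sz Q \<longrightarrow> R \<subseteq> Q')"
    and Lindeloef: "\<F> \<subseteq> \<Q> \<Longrightarrow> \<exists>\<C>\<subseteq>\<F>. countable \<C> \<and> \<Union>\<C> = \<Union>\<F>"
begin

lemma mult_average: "Q \<in> \<Q> \<Longrightarrow> emeasure M Q * average M Q f = (\<integral>\<^sup>+x\<in>Q. f x \<partial>M)"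
  by (simp add: average_def mult_divide_cancel_ennreal Q_pos Q_finite)

text \<open>Greedy selection: a member of greatest size is taken, its enlargement swallows
  everything that meets it, and the induction hypothesis handles the members disjoint from
  it.\<close>

lemma finite_Vitali:
  assumes "finite \<F>" "\<F> \<subseteq> \<Q>"
  shows "\<exists>\<G>\<subseteq>\<F>. disjoint \<G> \<and> emeasure M (\<Union>\<F>) \<le> N * (\<Sum>Q\<in>\<G>. emeasure M Q)"
  using assms
proof (induction \<F> rule: finite_psubset_induct)
  case (psubset \<F>)
  show ?case
  proof (cases "\<F> = {}")
    case False
    obtain P where P: "P \<in> \<F>" "\<And>R. R \<in> \<F> \<Longrightarrow> sz R \<le> sz P"
    proof -
      have "Max (sz ` \<F>) \<in> sz ` \<F>"
        using False psubset.hyps by (intro Max_in) auto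
      then obtain P where "P \<in> \<F>" "Max (sz ` \<F>) = sz P" by blast
      with psubset.hyps that show thesis
        by (metis Max_ge finite_imageI imageI)
    qed
    then have "P \<in> \<Q>" using psubset.prems by auto
    then obtain P' where P': "P' \<in> \<Q>" "P \<subseteq> P'" "emeasure M P' \<le> N * emeasure M P"
      "\<And>R. R \<in> \<Q> \<Longrightarrow> R \<inter> P \<noteq> {} \<Longrightarrow> sz R \<le> sz P \<Longrightarrow> R \<subseteq> P'"
      using enlarge by meson
    define \<F>' where "\<F>' = {R\<in>\<F>. R \<inter> P = {}}"
    have "P \<noteq> {}" using Q_pos[OF \<open>P \<in> \<Q>\<close>] by auto
    then have "\<F>' \<subset> \<F>" using P by (auto simp: \<F>'_def)
    moreover from this have "\<F>' \<subseteq> \<Q>" using psubset.prems by auto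
    ultimately obtain \<G> where \<G>: "\<G> \<subseteq> \<F>'" "disjoint \<G>"
      "emeasure M (\<Union>\<F>') \<le> N * (\<Sum>Q\<in>\<G>. emeasure M Q)"
      using psubset.IH by meson
    have fin: "finite \<F>'" "finite \<G>"
      using \<open>\<F>' \<subset> \<F>\<close> \<G>(1) psubset.hyps by (auto dest: finite_subset)
    have "P \<notin> \<G>" using \<G>(1) \<open>P \<noteq> {}\<close> by (auto simp: \<F>'_def)
    have "\<Union>\<F>' \<in> sets M" using fin \<open>\<F>' \<subseteq> \<Q>\<close> by (intro sets.finite_Union) auto
    have "R \<subseteq> P' \<union> \<Union>\<F>'" if "R \<in> \<F>" for R
      using that P(2)[OF that] P'(4)[of R] psubset.prems by (cases "R \<inter> P = {}") (auto simp: \<F>'_def)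
    then have "\<Union>\<F> \<subseteq> P' \<union> \<Union>\<F>'" by blast
    then have "emeasure M (\<Union>\<F>) \<le> emeasure M (P' \<union> \<Union>\<F>')"
      using P'(1) \<open>\<Union>\<F>' \<in> sets M\<close> by (intro emeasure_mono) auto
    also have "\<dots> \<le> emeasure M P' + emeasure M (\<Union>\<F>')"
      using P'(1) \<open>\<Union>\<F>' \<in> sets M\<close> by (intro emeasure_subadditive) auto
    also have "\<dots> \<le> N * emeasure M P + N * (\<Sum>Q\<in>\<G>. emeasure M Q)"
      by (intro add_mono P' \<G>)
    also have "\<dots> = N * (\<Sum>Q\<in>insert P \<G>. emeasure M Q)"
      using fin \<open>P \<notin> \<G>\<close> by (simp add: distrib_left)
    finally have "emeasure M (\<Union>\<F>) \<le> N * (\<Sum>Q\<in>insert P \<G>. emeasure M Q)" .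
    moreover have "disjoint (insert P \<G>)"
      using \<G>(1,2) by (auto simp: disjoint_def pairwise_insert disjnt_def \<F>'_def)
    moreover have "insert P \<G> \<subseteq> \<F>" using P(1) \<G>(1) \<open>\<F>' \<subset> \<F>\<close> by auto
    ultimately show ?thesis by blast
  qed auto
qed

section \<open>Level sets of the maximal function and the weak type estimate\<close>

lemma superlevel_eq:
  "{x. t < maximal M \<Q> f x} = \<Union>{Q\<in>\<Q>. t < average M Q f}"
  by (auto simp: maximal_def less_SUP_iff)

text \<open>The union in \<open>superlevel_eq\<close> may be uncountable; \<open>Lindeloef\<close>
  reduces it to a countable one.\<close>

lemma superlevel_sets: "{x. t < maximal M \<Q> f x} \<in> sets M"
proof -
  obtain \<C> where "\<C> \<subseteq> {Q\<in>\<Q>. t < average M Q f}" "countable \<C>" "\<Union>\<C> = {x. t < maximal M \<Q> f x}"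
    using Lindeloef[of "{Q\<in>\<Q>. t < average M Q f}"] unfolding superlevel_eq by auto
  moreover have "\<Union>\<C> \<in> sets M" using calculation by (intro sets.countable_Union) auto
  ultimately show ?thesis by simp
qed

lemma maximal_measurable [measurable]: "maximal M \<Q> f \<in> borel_measurable M"
proof (rule borel_measurableI_greater)
  fix t
  show "{x \<in> space M. t < maximal M \<Q> f x} \<in> sets M"
    using sets.Int[OF sets.top superlevel_sets[of t f]] by (simp add: Int_def)
qed

text \<open>On each member of the level set, \<open>t\<close> times its measure is at most the
  integral of \<open>f\<close> over it. For disjoint members these integrals add up to at most the
  total integral, and \<open>finite_Vitali\<close> selects disjoint members at the cost of
  \<open>N\<close>.\<close>

lemma weak_type_1_1:
  assumes [measurable]: "f \<in> borel_measurable M"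
  shows "t * emeasure M {x. t < maximal M \<Q> f x} \<le> N * (\<integral>\<^sup>+x. f x \<partial>M)"
proof -
  have fin: "t * emeasure M (\<Union>\<F>) \<le> N * (\<integral>\<^sup>+x. f x \<partial>M)"
    if "finite \<F>" "\<F> \<subseteq> {Q\<in>\<Q>. t < average M Q f}" for \<F>
  proof -
    have "\<F> \<subseteq> \<Q>" using that by auto
    with that obtain \<G> where
      \<G>: "\<G> \<subseteq> \<F>" "disjoint \<G>" "emeasure M (\<Union>\<F>) \<le> N * (\<Sum>Q\<in>\<G>. emeasure M Q)"
      using finite_Vitali[of \<F>] by meson
    have \<G>': "finite \<G>" "\<G> \<subseteq> {Q\<in>\<Q>. t < average M Q f}"
      using \<G>(1) that by (auto dest: finite_subset)
    have "t * emeasure M (\<Union>\<F>) \<le> t * (N * (\<Sum>Q\<in>\<G>. emeasure M Q))"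
      by (intro mult_left_mono \<G>) simp
    also have "\<dots> = N * (\<Sum>Q\<in>\<G>. emeasure M Q * t)"
      by (simp add: sum_distrib_left mult_ac)
    also have "\<dots> \<le> N * (\<Sum>Q\<in>\<G>. emeasure (density M f) Q)"
    proof (intro mult_left_mono sum_mono)
      fix Q assume "Q \<in> \<G>"
      then have Q: "Q \<in> \<Q>" "t < average M Q f" using \<G>' by auto
      have "emeasure M Q * t \<le> emeasure M Q * average M Q f"
        by (intro mult_left_mono) (use Q in auto)
      also have "\<dots> = emeasure (density M f) Q"
        using Q by (simp add: mult_average emeasure_density)
      finally show "emeasure M Q * t \<le> emeasure (density M f) Q" .
    qed simp
    also have "(\<Sum>Q\<in>\<G>. emeasure (density M f) Q) = emeasure (density M f) (\<Union>\<G>)"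
    proof -
      have "\<G> \<subseteq> sets M" using \<G>'(2) Q_sets by blast
      then show ?thesis
        using sum_emeasure[of "\<lambda>Q. Q" \<G> "density M f"] \<G>'(1) \<G>(2)
        by (auto simp: disjoint_def disjoint_family_on_def)
    qed
    also have "\<dots> \<le> emeasure (density M f) (space M)"
      by (metis emeasure_space space_density)
    also have "\<dots> = (\<integral>\<^sup>+x. f x \<partial>M)"
      by (simp add: emeasure_density nn_integral_set_ennreal cong: nn_integral_cong)
    finally show ?thesis by (simp add: mult_left_mono)
  qed
  obtain \<C> where \<C>: "\<C> \<subseteq> {Q\<in>\<Q>. t < average M Q f}" "countable \<C>"
    "\<Union>\<C> = {x. t < maximal M \<Q> f x}"
    using Lindeloef[of "{Q\<in>\<Q>. t < average M Q f}"] unfolding superlevel_eq by auto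
  show ?thesis
  proof (cases "\<C> = {}")
    case True
    with \<C> show ?thesis by (auto simp flip: \<C>(3))
  next
    case False
    \<comment> \<open>Finite unions along an enumeration exhaust the level set, so continuity from
      below transfers the bound for finite families.\<close>
    define A where "A n = \<Union>(from_nat_into \<C> ` {..<n})" for n
    have mem: "from_nat_into \<C> n \<in> \<C>" for n using False by (rule from_nat_into)
    have mem_sets: "from_nat_into \<C> n \<in> sets M" for n
      using mem[of n] \<C>(1) Q_sets by blast
    have "A n \<in> sets M" for n
      unfolding A_def using mem_sets by (intro sets.finite_Union) auto
    then have "range A \<subseteq> sets M" by auto
    moreover have "incseq A" by (intro incseq_SucI) (auto simp: A_def lessThan_Suc)
    moreover have "(\<Union>n. A n) = {x. t < maximal M \<Q> f x}"
    proof -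
      have "(\<Union>n. A n) = \<Union>(range (from_nat_into \<C>))"
        by (auto simp: A_def)
      then show ?thesis using range_from_nat_into[OF False \<C>(2)] \<C>(3) by simp
    qed
    ultimately have "emeasure M {x. t < maximal M \<Q> f x} = (SUP n. emeasure M (A n))"
      using SUP_emeasure_incseq[of A M] by simp
    then have "t * emeasure M {x. t < maximal M \<Q> f x} = (SUP n. t * emeasure M (A n))"
      by (simp add: SUP_mult_left_ennreal)
    also have "\<dots> \<le> N * (\<integral>\<^sup>+x. f x \<partial>M)"
      using \<C>(1) mem by (intro SUP_least) (auto simp: A_def intro!: fin)
    finally show ?thesis .
  qed
qed

text \<open>Values of \<open>f\<close> up to \<open>t\<close> raise an average by at most
  \<open>t\<close>. So where the maximal function exceeds \<open>2 * t\<close>, that of the part of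
  \<open>f\<close> above \<open>t\<close> still exceeds \<open>t\<close>.\<close>

lemma weak_type_truncated:
  assumes [measurable]: "f \<in> borel_measurable M"
  shows "t * emeasure M {x. 2 * t < maximal M \<Q> f x}
    \<le> N * (\<integral>\<^sup>+x. f x * indicator {y. t < y} (f x) \<partial>M)"
proof -
  define g where "g x = f x * indicator {y. t < y} (f x)" for x
  have [measurable]: "g \<in> borel_measurable M" unfolding g_def by measurable
  have "average M Q f \<le> average M Q g + t" if Q: "Q \<in> \<Q>" for Q
  proof -
    have [measurable]: "Q \<in> sets M" using Q by simp
    have "(\<integral>\<^sup>+x\<in>Q. f x \<partial>M) \<le> (\<integral>\<^sup>+x. g x * indicator Q x + t * indicator Q x \<partial>M)"
      by (intro nn_integral_mono) (auto simp: g_def indicator_def)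
    also have "\<dots> = (\<integral>\<^sup>+x\<in>Q. g x \<partial>M) + t * emeasure M Q"
      using Q by (simp add: nn_integral_add nn_integral_cmult_indicator)
    finally have "average M Q f \<le> ((\<integral>\<^sup>+x\<in>Q. g x \<partial>M) + t * emeasure M Q) / emeasure M Q"
      unfolding average_def by (rule divide_right_mono_ennreal)
    also have "\<dots> = average M Q g + t"
      using Q_pos[OF Q] Q_finite[OF Q]
      by (simp add: add_divide_distrib_ennreal average_def mult_divide_eq_ennreal)
    finally show ?thesis .
  qed
  then have *: "maximal M \<Q> f x \<le> maximal M \<Q> g x + t" for x
    by (intro maximal_least) (meson add_right_mono average_le_maximal order_trans)
  have "{x. 2 * t < maximal M \<Q> f x} \<subseteq> {x. t < maximal M \<Q> g x}"
  proof safe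
    fix x assume "2 * t < maximal M \<Q> f x"
    also have "\<dots> \<le> maximal M \<Q> g x + t" by (rule *)
    finally show "t < maximal M \<Q> g x"
      by (simp add: mult_2)
  qed
  then have "t * emeasure M {x. 2 * t < maximal M \<Q> f x} \<le> t * emeasure M {x. t < maximal M \<Q> g x}"
    by (intro mult_left_mono emeasure_mono superlevel_sets) auto
  also have "\<dots> \<le> N * (\<integral>\<^sup>+x. g x \<partial>M)" by (rule weak_type_1_1) simp
  finally show ?thesis by (simp add: g_def)
qed

text \<open>Marcinkiewicz interpolation: the maximal function is decomposed into layers, the
  truncated weak type estimate is applied to each, and the layers are summed again over the values
  of \<open>f\<close>. The constant combines \<open>4 powr p\<close> with the geometric series for
  exponent \<open>p - 1\<close>.\<close>

lemma strong_type:
  assumes [measurable]: "f \<in> borel_measurable M" and p: "1 < p"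
  shows "(\<integral>\<^sup>+x. maximal M \<Q> f x powe p \<partial>M)
    \<le> ennreal (4 powr p / (1 - 2 powr (1 - p))) * N * (\<integral>\<^sup>+x. f x powe p \<partial>M)"
proof -
  define t :: "int \<Rightarrow> ennreal" where "t n = ennreal (2 powr of_int n)" for n
  define r :: "int \<Rightarrow> real \<Rightarrow> ennreal" where "r n a = ennreal (2 powr (of_int n * a))" for n a
  \<comment> \<open>The weak type estimate consumes one factor \<open>t n\<close> of the layer
    weight; the remaining exponent \<open>p - 1\<close> is summed against \<open>f\<close>,
    restoring the power \<open>p\<close>.\<close>
  have r_p: "r n p = r n (p - 1) * t n" for n
    by (simp add: r_def t_def flip: ennreal_mult powr_add) (simp add: algebra_simps)
  have meas [measurable]: "(\<lambda>x. indicator {y. 2 * t n < y} (maximal M \<Q> f x) :: ennreal) \<in> borel_measurable M" for n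
    by measurable
  define c where "c = ennreal (4 powr p)"
  have "(\<integral>\<^sup>+x. maximal M \<Q> f x powe p \<partial>M)
    \<le> (\<integral>\<^sup>+x. (\<integral>\<^sup>+n. c * r n p * indicator {y. 2 * t n < y} (maximal M \<Q> f x)
        \<partial>count_space UNIV) \<partial>M)"
    unfolding r_def t_def c_def mult.assoc using p
    by (intro nn_integral_mono, subst nn_integral_cmult) (auto intro!: powe_le_layers)
  also have "\<dots> = (\<integral>\<^sup>+n. (\<integral>\<^sup>+x. c * r n p * indicator {y. 2 * t n < y} (maximal M \<Q> f x) \<partial>M)
        \<partial>count_space UNIV)"
    by (intro nn_integral_count_space_nn_integral) auto
  also have "\<dots> \<le> (\<integral>\<^sup>+n. (\<integral>\<^sup>+x. c * N * f x * (r n (p - 1) * indicator {y. t n < y} (f x)) \<partial>M)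
        \<partial>count_space UNIV)"
  proof (rule nn_integral_mono)
    fix n :: int
    have "(\<integral>\<^sup>+x. c * r n p * indicator {y. 2 * t n < y} (maximal M \<Q> f x) \<partial>M)
      = c * r n p * emeasure M {x. 2 * t n < maximal M \<Q> f x}"
    proof -
      have "indicator {y. 2 * t n < y} (maximal M \<Q> f x)
          = (indicator {x. 2 * t n < maximal M \<Q> f x} x :: ennreal)" for x
        by (simp add: indicator_def)
      then show ?thesis
        using superlevel_sets by (simp add: nn_integral_cmult_indicator)
    qed
    also have "\<dots> = c * r n (p - 1) * (t n * emeasure M {x. 2 * t n < maximal M \<Q> f x})"
      by (simp add: r_p mult_ac)
    also have "\<dots> \<le> c * r n (p - 1) * (N * (\<integral>\<^sup>+x. f x * indicator {y. t n < y} (f x) \<partial>M))"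
      by (intro mult_left_mono weak_type_truncated) auto
    also have "\<dots> = (\<integral>\<^sup>+x. c * N * f x * (r n (p - 1) * indicator {y. t n < y} (f x)) \<partial>M)"
      by (simp add: nn_integral_cmult[symmetric] mult_ac)
    finally show "(\<integral>\<^sup>+x. c * r n p * indicator {y. 2 * t n < y} (maximal M \<Q> f x) \<partial>M)
      \<le> (\<integral>\<^sup>+x. c * N * f x * (r n (p - 1) * indicator {y. t n < y} (f x)) \<partial>M)" .
  qed
  also have "\<dots> = (\<integral>\<^sup>+x. (\<integral>\<^sup>+n. c * N * f x * (r n (p - 1) * indicator {y. t n < y} (f x))
        \<partial>count_space UNIV) \<partial>M)"
    by (intro nn_integral_count_space_nn_integral[symmetric]) auto
  also have "\<dots> \<le> (\<integral>\<^sup>+x. c * N * f x * (ennreal (1 / (1 - 2 powr - (p - 1))) * f x powe (p - 1)) \<partial>M)"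
  proof (rule nn_integral_mono)
    fix x
    show "(\<integral>\<^sup>+n. c * N * f x * (r n (p - 1) * indicator {y. t n < y} (f x)) \<partial>count_space UNIV)
        \<le> c * N * f x * (ennreal (1 / (1 - 2 powr - (p - 1))) * f x powe (p - 1))"
      unfolding r_def t_def using p layers_le_powe[of "p - 1" "f x"]
      by (subst nn_integral_cmult) (auto intro!: mult_left_mono)
  qed
  also have "\<dots> = (\<integral>\<^sup>+x. c * ennreal (1 / (1 - 2 powr - (p - 1))) * N * f x powe p \<partial>M)"
  proof (intro nn_integral_cong)
    fix x
    have "f x * f x powe (p - 1) = f x powe p"
      using powe_add[of "f x" 1 "p - 1"] p by simp
    then show "c * N * f x * (ennreal (1 / (1 - 2 powr - (p - 1))) * f x powe (p - 1))
        = c * ennreal (1 / (1 - 2 powr - (p - 1))) * N * f x powe p"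
      by (metis mult.assoc mult.left_commute)
  qed
  also have "\<dots> = c * ennreal (1 / (1 - 2 powr - (p - 1))) * N * (\<integral>\<^sup>+x. f x powe p \<partial>M)"
    by (simp add: nn_integral_cmult)
  also have "c * ennreal (1 / (1 - 2 powr - (p - 1)))
      = ennreal (4 powr p / (1 - 2 powr (1 - p)))"
  proof -
    have "2 powr (1 - p) < (1::real)" using p by (simp add: powr_less_one)
    then show ?thesis unfolding c_def by (subst ennreal_mult[symmetric]) auto
  qed
  finally show ?thesis .
qed

end

section \<open>Muckenhoupt weights\<close>

text \<open>\<open>joint\<close> lets mass anywhere influence the maximal function everywhere on the
  union of the family, which is what makes the majorants positive.\<close>

locale doubling_family = vitali_family +
  assumes N_finite: "N < top"
    and joint: "P \<in> \<Q> \<Longrightarrow> Q \<in> \<Q> \<Longrightarrow> \<exists>R\<in>\<Q>. P \<subseteq> R \<and> Q \<subseteq> R"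
    and cover: "AE x in M. x \<in> \<Union>\<Q>"
    and nonempty: "\<Q> \<noteq> {}"
begin

lemma set_nn_integral_pos:
  assumes [measurable]: "u \<in> borel_measurable M" and "AE x in M. 0 < u x" and Q: "Q \<in> \<Q>"
  shows "0 < (\<integral>\<^sup>+x\<in>Q. u x \<partial>M)"
proof (rule ccontr)
  have [measurable]: "Q \<in> sets M" using Q by simp
  assume "\<not> ?thesis"
  then have "AE x in M. u x * indicator Q x = 0"
    by (simp add: nn_integral_0_iff_AE)
  with assms(2) have "AE x in M. x \<notin> Q"
    by eventually_elim (auto simp: indicator_def split: if_splits)
  then have "emeasure M Q = 0" by (simp add: AE_iff_null_sets null_setsD1)
  with Q_pos[OF Q] show False by simp
qed

end

text \<open>\<open>s\<close> is a parameter so that exchanging \<open>w\<close> and \<open>s\<close>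
  gives another instance of the locale. \<open>Ap\<close> is the A_q-condition multiplied by
  \<open>emeasure M Q powe q\<close>, which removes the quotients.\<close>

locale weight_pair = doubling_family +
  fixes w s :: "'a \<Rightarrow> ennreal" and q :: real and K :: ennreal
  assumes q: "1 < q" and K_finite: "K < top"
    and w_measurable [measurable]: "w \<in> borel_measurable M"
    and s_measurable [measurable]: "s \<in> borel_measurable M"
    and w_pos: "AE x in M. 0 < w x \<and> w x < top"
    and s_eq: "AE x in M. s x = w x powe (- 1 / (q - 1))"
    and w_finite: "Q \<in> \<Q> \<Longrightarrow> (\<integral>\<^sup>+x\<in>Q. w x \<partial>M) < top"
    and Ap: "Q \<in> \<Q> \<Longrightarrow> (\<integral>\<^sup>+x\<in>Q. w x \<partial>M) * (\<integral>\<^sup>+x\<in>Q. s x \<partial>M) powe (q - 1) \<le> K * emeasure M Q powe q"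
begin

lemma s_pos: "AE x in M. 0 < s x \<and> s x < top"
  using w_pos s_eq by eventually_elim (metis powe_pos_finite)

lemma w_eq: "AE x in M. w x = s x powe (1 - q)"
  using s_eq
proof eventually_elim
  case (elim x)
  have "- 1 / (q - 1) * (1 - q) = 1" using q by (simp add: field_simps)
  then show ?case using elim by (simp add: powe_powe)
qed

text \<open>The product in \<open>Ap\<close> is finite and its first factor is positive, so the
  second factor must be finite.\<close>

lemma s_finite:
  assumes Q: "Q \<in> \<Q>" shows "(\<integral>\<^sup>+x\<in>Q. s x \<partial>M) < top"
proof -
  have "0 < (\<integral>\<^sup>+x\<in>Q. w x \<partial>M)"
    using w_pos by (intro set_nn_integral_pos Q) auto
  moreover have "(\<integral>\<^sup>+x\<in>Q. w x \<partial>M) * (\<integral>\<^sup>+x\<in>Q. s x \<partial>M) powe (q - 1) < top"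
    using K_finite Q_finite[OF Q] Q_pos[OF Q] powe_pos_finite
    by (intro le_less_trans[OF Ap[OF Q]]) (simp add: ennreal_mult_less_top)
  ultimately have "(\<integral>\<^sup>+x\<in>Q. s x \<partial>M) powe (q - 1) < top"
    by (auto simp: ennreal_mult_less_top)
  then show ?thesis using q by (simp add: powe_less_top_iff)
qed

text \<open>Raising \<open>Ap\<close> to the power \<open>1 / (q - 1)\<close> exchanges the roles of
  \<open>w\<close> and \<open>s\<close>, because \<open>q' - 1 = 1 / (q - 1)\<close> for the
  conjugate exponent \<open>q'\<close>.\<close>

lemma dual: "weight_pair M \<Q> sz N s w (q / (q - 1)) (K powe (1 / (q - 1)))"
proof -
  have q': "q / (q - 1) - 1 = 1 / (q - 1)" using q by (simp add: field_simps)
  show ?thesis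
  proof
    show "1 < q / (q - 1)" using q by (simp add: field_simps)
    show "K powe (1 / (q - 1)) < top" using K_finite q by (simp add: powe_less_top_iff)
    show "AE x in M. 0 < s x \<and> s x < top" by (rule s_pos)
    show "AE x in M. w x = s x powe (- 1 / (q / (q - 1) - 1))"
      unfolding q' using w_eq by simp
    show "(\<integral>\<^sup>+x\<in>Q. s x \<partial>M) * (\<integral>\<^sup>+x\<in>Q. w x \<partial>M) powe (q / (q - 1) - 1)
        \<le> K powe (1 / (q - 1)) * emeasure M Q powe (q / (q - 1))" if "Q \<in> \<Q>" for Q
      unfolding q'
      using powe_mono[of "1 / (q - 1)", OF _ Ap[OF that]] q
      by (simp add: powe_mult powe_powe mult.commute)
  qed (use s_finite in auto)
qed

text \<open>The reverse of \<open>Ap\<close>, with constant 1: almost everywhere 1 factors as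
  \<open>w powe (1 / q) * s powe (1 - 1 / q)\<close>.\<close>

lemma emeasure_le_Hoelder:
  assumes Q: "Q \<in> \<Q>"
  shows "emeasure M Q powe q \<le> (\<integral>\<^sup>+x\<in>Q. w x \<partial>M) * (\<integral>\<^sup>+x\<in>Q. s x \<partial>M) powe (q - 1)"
proof -
  have [measurable]: "Q \<in> sets M" using Q by simp
  have q1: "0 < 1 / q" "1 / q < 1" using q by auto
  have "emeasure M Q = (\<integral>\<^sup>+x. indicator Q x \<partial>M)" by simp
  also have "\<dots> = (\<integral>\<^sup>+x. (w x * indicator Q x) powe (1 / q) * (s x * indicator Q x) powe (1 - 1 / q) \<partial>M)"
  proof (intro nn_integral_cong_AE)
    show "AE x in M. indicator Q x = (w x * indicator Q x) powe (1 / q) * (s x * indicator Q x) powe (1 - 1 / q)"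
      using w_pos s_eq
    proof eventually_elim
      case (elim x)
      have "- 1 / (q - 1) * (1 - 1 / q) = - (1 / q)" using q by (simp add: field_simps)
      then have "w x powe (1 / q) * s x powe (1 - 1 / q) = w x powe (1 / q + - (1 / q))"
        using elim by (subst powe_add) (auto simp: powe_powe)
      then show ?case using q1 by (auto simp: indicator_def)
    qed
  qed
  also have "\<dots> \<le> (\<integral>\<^sup>+x\<in>Q. w x \<partial>M) powe (1 / q) * (\<integral>\<^sup>+x\<in>Q. s x \<partial>M) powe (1 - 1 / q)"
    by (intro nn_integral_Hoelder q1) measurable
  finally have "emeasure M Q powe q
      \<le> ((\<integral>\<^sup>+x\<in>Q. w x \<partial>M) powe (1 / q) * (\<integral>\<^sup>+x\<in>Q. s x \<partial>M) powe (1 - 1 / q)) powe q"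
    using q by (intro powe_mono) auto
  also have "\<dots> = (\<integral>\<^sup>+x\<in>Q. w x \<partial>M) * (\<integral>\<^sup>+x\<in>Q. s x \<partial>M) powe (q - 1)"
    using q by (simp add: powe_mult powe_powe left_diff_distrib)
  finally show ?thesis .
qed

lemma emeasure_density_w: "Q \<in> \<Q> \<Longrightarrow> emeasure (density M w) Q = (\<integral>\<^sup>+x\<in>Q. w x \<partial>M)"
  by (simp add: emeasure_density)

text \<open>The doubling property passes to the density \<open>w\<close> by comparing Hoelder on
  \<open>Q\<close> with \<open>Ap\<close> on the enlarged set, the integral of \<open>s\<close>
  growing from the first to the second. The quotient of the two measures enters with power
  \<open>q\<close>, hence \<open>K * N powe q\<close>.\<close>

lemma weighted_vitali_family: "vitali_family (density M w) \<Q> sz (K * N powe q)"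
proof
  fix Q assume Q: "Q \<in> \<Q>"
  show "Q \<in> sets (density M w)" using Q by simp
  show "0 < emeasure (density M w) Q"
    unfolding emeasure_density_w[OF Q] using w_pos by (intro set_nn_integral_pos Q) auto
  show "emeasure (density M w) Q < top"
    unfolding emeasure_density_w[OF Q] by (rule w_finite[OF Q])
  obtain Q' where Q': "Q' \<in> \<Q>" "Q \<subseteq> Q'" "emeasure M Q' \<le> N * emeasure M Q"
    "\<forall>R\<in>\<Q>. R \<inter> Q \<noteq> {} \<longrightarrow> sz R \<le> sz Q \<longrightarrow> R \<subseteq> Q'"
    using enlarge[OF Q] by auto
  have [measurable]: "Q \<in> sets M" "Q' \<in> sets M" using Q Q' by auto
  let ?w = "\<lambda>Q. \<integral>\<^sup>+x\<in>Q. w x \<partial>M" and ?s = "\<lambda>Q. \<integral>\<^sup>+x\<in>Q. s x \<partial>M"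
  have "emeasure M Q powe q * ?w Q' \<le> ?w Q * ?s Q powe (q - 1) * ?w Q'"
    by (intro mult_right_mono emeasure_le_Hoelder Q) auto
  also have "\<dots> \<le> ?w Q * ?s Q' powe (q - 1) * ?w Q'"
    using q Q' by (intro mult_right_mono mult_left_mono powe_mono nn_integral_mono)
      (auto simp: indicator_def)
  also have "\<dots> \<le> ?w Q * (K * emeasure M Q' powe q)"
    using Ap[OF Q'(1)] by (simp add: mult.assoc mult_left_mono mult.commute[of "_ powe _"])
  also have "\<dots> \<le> ?w Q * (K * (N * emeasure M Q) powe q)"
    using q Q' by (intro mult_left_mono powe_mono) auto
  also have "\<dots> = emeasure M Q powe q * (K * N powe q * ?w Q)"
    using q by (simp add: powe_mult mult_ac)
  finally have "?w Q' \<le> K * N powe q * ?w Q"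
    using powe_pos_finite[OF Q_pos[OF Q] Q_finite[OF Q], of q]
    by (subst (asm) ennreal_mult_le_mult_iff) auto
  then show "\<exists>Q'\<in>\<Q>. Q \<subseteq> Q' \<and> emeasure (density M w) Q' \<le> K * N powe q * emeasure (density M w) Q \<and>
      (\<forall>R\<in>\<Q>. R \<inter> Q \<noteq> {} \<longrightarrow> sz R \<le> sz Q \<longrightarrow> R \<subseteq> Q')"
    using Q Q' by (intro bexI[of _ Q']) (auto simp: emeasure_density_w)
qed (rule Lindeloef)

end

definition strong_const :: "real \<Rightarrow> real" where
  "strong_const p = 4 powr p / (1 - 2 powr (1 - p))"

text \<open>It bounds the \<open>q\<close>-th power of the operator norm. The three factors come
  from the pointwise domination, from \<open>strong_type\<close> with density \<open>w\<close> at
  exponent \<open>q'\<close>, and from \<open>strong_type\<close> with density \<open>s\<close> at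
  exponent \<open>q\<close>.\<close>

definition Muckenhoupt_const :: "real \<Rightarrow> ennreal \<Rightarrow> ennreal \<Rightarrow> ennreal" where
  "Muckenhoupt_const q K N = (let q' = q / (q - 1) in
     K powe q' * (ennreal (strong_const q') * (K * N powe q)) *
       (ennreal (strong_const q) * (K powe (1 / (q - 1)) * N powe q')))"

lemma Muckenhoupt_const_finite:
  "1 < q \<Longrightarrow> K < top \<Longrightarrow> N < top \<Longrightarrow> Muckenhoupt_const q K N < top"
  by (simp add: Muckenhoupt_const_def Let_def ennreal_mult_less_top powe_less_top_iff)

context weight_pair
begin

text \<open>Lerner's argument: the maximal function is dominated by the composition of the two maximal
  functions with respect to the measures \<open>w\<close> and \<open>s\<close>, both of which satisfy the unweighted
  estimate because they are doubling.\<close>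

lemma maximal_weighted_bound:
  assumes [measurable]: "f \<in> borel_measurable M"
  shows "(\<integral>\<^sup>+x. maximal M \<Q> f x powe q * w x \<partial>M)
    \<le> Muckenhoupt_const q K N * (\<integral>\<^sup>+x. f x powe q * w x \<partial>M)"
proof -
  define q' where "q' = q / (q - 1)"
  have q': "1 < q'" "q - 1 = q / q'" "1 / (q - 1) * q = q'" "(q - 1) * q' = q"
    using q by (auto simp: q'_def field_simps)
  interpret dual: weight_pair M \<Q> sz N s w q' "K powe (1 / (q - 1))"
    unfolding q'_def by (rule dual)
  interpret W: vitali_family "density M w" \<Q> sz "K * N powe q"
    by (rule weighted_vitali_family)
  interpret S: vitali_family "density M s" \<Q> sz "K powe (1 / (q - 1)) * N powe q'"
    by (rule dual.weighted_vitali_family)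
  \<comment> \<open>Dividing by \<open>s\<close> turns integrals of \<open>f\<close> over members
    into \<open>s\<close>-integrals of \<open>\<phi>\<close>; below, \<open>\<psi>\<close> does the
    same for \<open>m powe (q - 1)\<close> and \<open>w\<close>.\<close>
  define \<phi> where "\<phi> x = f x * s x powe (- 1)" for x
  have [measurable]: "\<phi> \<in> borel_measurable M" unfolding \<phi>_def by measurable
  define m where "m = maximal (density M s) \<Q> \<phi>"
  have [measurable]: "m \<in> borel_measurable M"
    using S.maximal_measurable[of \<phi>] by (simp add: m_def)
  define \<psi> where "\<psi> x = m x powe (q - 1) * w x powe (- 1)" for x
  have [measurable]: "\<psi> \<in> borel_measurable M" unfolding \<psi>_def by measurable
  define W where "W = maximal (density M w) \<Q> \<psi>"
  have [measurable]: "W \<in> borel_measurable M"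
    using W.maximal_measurable[of \<psi>] by (simp add: W_def)
  have cancel: "y * y powe (- 1) = 1" if "0 < y \<and> y < top" for y :: ennreal
    using powe_add[of y 1 "- 1"] that by simp
  \<comment> \<open>The average of \<open>f\<close> is the \<open>s\<close>-average \<open>b\<close>
    of \<open>\<phi>\<close> times the quotient of the \<open>s\<close>-mass and the measure of
    \<open>Q\<close>. Since \<open>b \<le> m\<close> on \<open>Q\<close>,
    \<open>b powe (q - 1)\<close> is at most the average of \<open>m powe (q - 1)\<close>, which is
    a \<open>w\<close>-average of \<open>\<psi>\<close> times the quotient for \<open>w\<close>. The
    two quotients combine to exactly the expression bounded by \<open>K\<close>.\<close>
  have avg: "average M Q f powe (q - 1) \<le> K * W x" if Q: "Q \<in> \<Q>" and x: "x \<in> Q" for Q x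
  proof -
    have [measurable]: "Q \<in> sets M" using Q by simp
    define b where "b = average (density M s) Q \<phi>"
    have "emeasure M Q * average M Q f = (\<integral>\<^sup>+x\<in>Q. f x \<partial>M)"
      using Q by (rule mult_average)
    also have "\<dots> = (\<integral>\<^sup>+x. s x * (\<phi> x * indicator Q x) \<partial>M)"
    proof (intro nn_integral_cong_AE)
      show "AE x in M. f x * indicator Q x = s x * (\<phi> x * indicator Q x)"
        using s_pos
      proof eventually_elim
        case (elim x)
        then show ?case
          using cancel[OF elim] by (simp add: \<phi>_def) (metis mult.assoc mult.commute mult.right_neutral)
      qed
    qed
    also have "\<dots> = (\<integral>\<^sup>+x\<in>Q. \<phi> x \<partial>density M s)"
      by (simp add: nn_integral_density)
    also have "\<dots> = (\<integral>\<^sup>+x\<in>Q. s x \<partial>M) * b"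
      using S.mult_average[OF Q] dual.emeasure_density_w[OF Q] by (simp add: b_def)
    finally have a: "emeasure M Q * average M Q f = (\<integral>\<^sup>+x\<in>Q. s x \<partial>M) * b" .
    have "emeasure M Q * b powe (q - 1) = (\<integral>\<^sup>+x. b powe (q - 1) * indicator Q x \<partial>M)"
      using Q by (simp add: nn_integral_cmult_indicator) (rule mult.commute)
    also have "\<dots> \<le> (\<integral>\<^sup>+x. w x * (\<psi> x * indicator Q x) \<partial>M)"
    proof (intro nn_integral_mono_AE)
      show "AE x in M. b powe (q - 1) * indicator Q x \<le> w x * (\<psi> x * indicator Q x)"
        using w_pos
      proof eventually_elim
        case (elim x)
        have "b powe (q - 1) \<le> m x powe (q - 1)" if "x \<in> Q"
          unfolding b_def m_def using q Q that by (intro powe_mono average_le_maximal) auto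
        moreover have "w x * \<psi> x = m x powe (q - 1)"
          using cancel[OF elim] by (simp add: \<psi>_def) (metis mult.left_commute mult.right_neutral)
        ultimately show ?case by (auto simp: indicator_def)
      qed
    qed
    also have "\<dots> = (\<integral>\<^sup>+x\<in>Q. \<psi> x \<partial>density M w)"
      by (simp add: nn_integral_density)
    also have "\<dots> = (\<integral>\<^sup>+x\<in>Q. w x \<partial>M) * average (density M w) Q \<psi>"
      using W.mult_average[OF Q] emeasure_density_w[OF Q] by simp
    also have "\<dots> \<le> (\<integral>\<^sup>+x\<in>Q. w x \<partial>M) * W x"
      unfolding W_def by (intro mult_left_mono average_le_maximal Q x) auto
    finally have b: "emeasure M Q * b powe (q - 1) \<le> (\<integral>\<^sup>+x\<in>Q. w x \<partial>M) * W x" .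
    have "emeasure M Q powe q * average M Q f powe (q - 1)
        = emeasure M Q * (emeasure M Q * average M Q f) powe (q - 1)"
      using q powe_add[of "emeasure M Q" 1 "q - 1"] by (simp add: powe_mult mult_ac)
    also have "\<dots> = (\<integral>\<^sup>+x\<in>Q. s x \<partial>M) powe (q - 1) * (emeasure M Q * b powe (q - 1))"
      unfolding a using q by (simp add: powe_mult mult_ac)
    also have "\<dots> \<le> (\<integral>\<^sup>+x\<in>Q. s x \<partial>M) powe (q - 1) * ((\<integral>\<^sup>+x\<in>Q. w x \<partial>M) * W x)"
      by (intro mult_left_mono b) auto
    also have "\<dots> = ((\<integral>\<^sup>+x\<in>Q. w x \<partial>M) * (\<integral>\<^sup>+x\<in>Q. s x \<partial>M) powe (q - 1)) * W x"
      by (simp add: mult_ac)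
    also have "\<dots> \<le> K * emeasure M Q powe q * W x"
      by (intro mult_right_mono Ap Q) auto
    also have "\<dots> = emeasure M Q powe q * (K * W x)" by (simp add: mult_ac)
    finally show ?thesis
      using powe_pos_finite[OF Q_pos[OF Q] Q_finite[OF Q], of q]
      by (subst (asm) ennreal_mult_le_mult_iff) auto
  qed
  have pointwise: "maximal M \<Q> f x powe q \<le> (K * W x) powe q'" for x
  proof -
    have "maximal M \<Q> f x \<le> (K * W x) powe (1 / (q - 1))"
    proof (rule maximal_least)
      fix Q assume "Q \<in> \<Q>" "x \<in> Q"
      then have "(average M Q f powe (q - 1)) powe (1 / (q - 1)) \<le> (K * W x) powe (1 / (q - 1))"
        using q by (intro powe_mono avg) auto
      then show "average M Q f \<le> (K * W x) powe (1 / (q - 1))" using q by (simp add: powe_powe)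
    qed
    then have "maximal M \<Q> f x powe q \<le> ((K * W x) powe (1 / (q - 1))) powe q"
      using q by (intro powe_mono) auto
    also have "\<dots> = (K * W x) powe q'" unfolding powe_powe q'(3) ..
    finally show ?thesis .
  qed
  have "(\<integral>\<^sup>+x. maximal M \<Q> f x powe q * w x \<partial>M) \<le> (\<integral>\<^sup>+x. K powe q' * (w x * W x powe q') \<partial>M)"
  proof (intro nn_integral_mono)
    fix x
    have "maximal M \<Q> f x powe q * w x \<le> (K * W x) powe q' * w x"
      by (intro mult_right_mono pointwise) auto
    then show "maximal M \<Q> f x powe q * w x \<le> K powe q' * (w x * W x powe q')"
      using q' by (simp add: powe_mult mult_ac)
  qed
  also have "\<dots> = K powe q' * (\<integral>\<^sup>+x. W x powe q' \<partial>density M w)"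
    by (simp add: nn_integral_cmult nn_integral_density)
  also have "\<dots> \<le> K powe q' * (ennreal (strong_const q') * (K * N powe q) * (\<integral>\<^sup>+x. \<psi> x powe q' \<partial>density M w))"
    unfolding W_def strong_const_def
    by (intro mult_left_mono W.strong_type q') auto
  also have "(\<integral>\<^sup>+x. \<psi> x powe q' \<partial>density M w) = (\<integral>\<^sup>+x. w x * \<psi> x powe q' \<partial>M)"
    by (simp add: nn_integral_density)
  also have "\<dots> = (\<integral>\<^sup>+x. s x * m x powe q \<partial>M)"
  proof (intro nn_integral_cong_AE)
    show "AE x in M. w x * \<psi> x powe q' = s x * m x powe q"
      using w_pos s_eq
    proof eventually_elim
      case (elim x)
      have "1 + - q' = - 1 / (q - 1)" using q by (simp add: q'_def field_simps)
      then have "w x * w x powe (- q') = s x"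
        using powe_add[of "w x" 1 "- q'"] elim by simp
      moreover have "\<psi> x powe q' = m x powe q * w x powe (- q')"
        unfolding \<psi>_def using q' by (simp add: powe_mult powe_powe)
      ultimately show ?case by (metis mult.left_commute mult.commute)
    qed
  qed
  also have "\<dots> = (\<integral>\<^sup>+x. m x powe q \<partial>density M s)"
    by (simp add: nn_integral_density)
  also have "K powe q' * (ennreal (strong_const q') * (K * N powe q) * \<dots>)
      \<le> K powe q' * (ennreal (strong_const q') * (K * N powe q) *
          (ennreal (strong_const q) * (K powe (1 / (q - 1)) * N powe q') * (\<integral>\<^sup>+x. \<phi> x powe q \<partial>density M s)))"
    unfolding m_def strong_const_def[of q]
    by (intro mult_left_mono S.strong_type q) auto
  also have "(\<integral>\<^sup>+x. \<phi> x powe q \<partial>density M s) = (\<integral>\<^sup>+x. s x * \<phi> x powe q \<partial>M)"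
    by (simp add: nn_integral_density)
  also have "\<dots> = (\<integral>\<^sup>+x. f x powe q * w x \<partial>M)"
  proof (intro nn_integral_cong_AE)
    show "AE x in M. s x * \<phi> x powe q = f x powe q * w x"
      using s_pos w_eq
    proof eventually_elim
      case (elim x)
      have "s x * s x powe (- q) = w x"
        using powe_add[of "s x" 1 "- q"] elim by simp
      moreover have "\<phi> x powe q = f x powe q * s x powe (- q)"
        unfolding \<phi>_def using q by (simp add: powe_mult powe_powe)
      ultimately show ?case by (metis mult.left_commute mult.commute)
    qed
  qed
  finally show ?thesis
    by (simp add: Muckenhoupt_const_def Let_def mult_ac flip: q'_def)
qed

end

section \<open>The Rubio de Francia iteration\<close>

text \<open>Hoelder for the counting measure, with the convex weights \<open>v\<close> split between
  the two factors.\<close>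

lemma suminf_Jensen:
  fixes v x :: "nat \<Rightarrow> ennreal"
  assumes "(\<Sum>k. v k) = 1" "1 < q"
  shows "(\<Sum>k. v k * x k) powe q \<le> (\<Sum>k. v k * x k powe q)"
proof -
  have q: "0 < 1 / q" "1 / q < 1" using assms by auto
  have "v k * x k = (v k * x k powe q) powe (1 / q) * v k powe (1 - 1 / q)" for k
  proof -
    have "(v k * x k powe q) powe (1 / q) * v k powe (1 - 1 / q)
        = (v k powe (1 / q) * v k powe (1 - 1 / q)) * x k"
      using assms by (simp add: powe_mult powe_powe mult_ac)
    also have "v k powe (1 / q) * v k powe (1 - 1 / q) = v k"
      using q by (subst powe_add[symmetric]) auto
    finally show ?thesis by simp
  qed
  then have "(\<Sum>k. v k * x k)
      = (\<integral>\<^sup>+k. (v k * x k powe q) powe (1 / q) * v k powe (1 - 1 / q) \<partial>count_space UNIV)"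
    by (simp add: nn_integral_count_space_nat)
  also have "\<dots> \<le> (\<integral>\<^sup>+k. v k * x k powe q \<partial>count_space UNIV) powe (1 / q)
      * (\<integral>\<^sup>+k. v k \<partial>count_space UNIV) powe (1 - 1 / q)"
    using q by (intro nn_integral_Hoelder) auto
  also have "\<dots> = (\<Sum>k. v k * x k powe q) powe (1 / q)"
    using assms by (simp add: nn_integral_count_space_nat)
  finally have "(\<Sum>k. v k * x k) powe q \<le> ((\<Sum>k. v k * x k powe q) powe (1 / q)) powe q"
    using assms by (intro powe_mono) auto
  then show ?thesis using assms by (simp add: powe_powe)
qed

text \<open>In use, \<open>A\<close> bounds the \<open>q\<close>-th power of the norm of the maximal
  operator. As \<open>1 \<le> A\<close>, it also bounds the norm itself, so the \<open>k\<close>-th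
  term has norm at most \<open>(1 / 2) ^ k\<close> times that of \<open>h\<close>.\<close>

definition Rubio :: "'a measure \<Rightarrow> 'a set set \<Rightarrow> real \<Rightarrow> ('a \<Rightarrow> ennreal) \<Rightarrow> 'a \<Rightarrow> ennreal" where
  "Rubio M \<Q> A h x = (\<Sum>k. ennreal ((1 / (2 * A)) ^ k) * (maximal M \<Q> ^^ k) h x)"

context vitali_family
begin

lemma maximal_funpow_measurable [measurable]:
  assumes [measurable]: "h \<in> borel_measurable M"
  shows "(maximal M \<Q> ^^ k) h \<in> borel_measurable M"
  by (cases k) auto

lemma Rubio_measurable [measurable]:
  assumes [measurable]: "h \<in> borel_measurable M"
  shows "Rubio M \<Q> A h \<in> borel_measurable M"
  unfolding Rubio_def by measurable

lemma Rubio_ge_term: "ennreal ((1 / (2 * A)) ^ k) * (maximal M \<Q> ^^ k) h x \<le> Rubio M \<Q> A h x"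
  unfolding Rubio_def
  using sum_le_suminf[of "\<lambda>k. ennreal ((1 / (2 * A)) ^ k) * (maximal M \<Q> ^^ k) h x" "{k}"] by simp

lemma Rubio_ge: "h x \<le> Rubio M \<Q> A h x"
  using Rubio_ge_term[of A 0 h x] by simp

text \<open>The A_1-property: the average of the \<open>k\<close>-th iterate is at most the next
  iterate, so averaging shifts the series by one place, and realigning the coefficients costs
  \<open>2 * A\<close>.\<close>

lemma average_Rubio_le:
  assumes [measurable]: "h \<in> borel_measurable M" and A: "1 \<le> A" and Q: "Q \<in> \<Q>" "x \<in> Q"
  shows "average M Q (Rubio M \<Q> A h) \<le> ennreal (2 * A) * Rubio M \<Q> A h x"
proof -
  have [measurable]: "Q \<in> sets M" using Q by simp
  define e where "e k = ennreal ((1 / (2 * A)) ^ k)" for k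
  let ?T = "\<lambda>k. (maximal M \<Q> ^^ k) h"
  have "(\<integral>\<^sup>+x\<in>Q. Rubio M \<Q> A h x \<partial>M) = (\<integral>\<^sup>+x. (\<Sum>k. e k * (?T k x * indicator Q x)) \<partial>M)"
    unfolding Rubio_def e_def by (simp add: mult.assoc flip: ennreal_suminf_multc)
  also have "\<dots> = (\<Sum>k. e k * (\<integral>\<^sup>+x\<in>Q. ?T k x \<partial>M))"
    by (subst nn_integral_suminf) (auto simp: nn_integral_cmult)
  finally have "average M Q (Rubio M \<Q> A h) = (\<Sum>k. e k * average M Q (?T k))"
    unfolding average_def by (simp add: ennreal_times_divide flip: ennreal_suminf_divide)
  also have "\<dots> \<le> (\<Sum>k. ennreal (2 * A) * (e (Suc k) * ?T (Suc k) x))"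
  proof (intro suminf_le)
    fix k
    have "e k = ennreal (2 * A) * e (Suc k)"
      using A by (simp add: e_def flip: ennreal_mult)
    then show "e k * average M Q (?T k) \<le> ennreal (2 * A) * (e (Suc k) * ?T (Suc k) x)"
      using Q by (simp add: mult.assoc) (intro mult_left_mono average_le_maximal; simp)
  qed auto
  also have "\<dots> = ennreal (2 * A) * (\<Sum>k. e (Suc k) * ?T (Suc k) x)"
    by (rule ennreal_suminf_cmult)
  also have "\<dots> \<le> ennreal (2 * A) * Rubio M \<Q> A h x"
  proof (intro mult_left_mono)
    have "Rubio M \<Q> A h x = (\<Sum>k. e (Suc k) * ?T (Suc k) x) + e 0 * ?T 0 x"
      unfolding Rubio_def e_def[symmetric]
      using suminf_offset[of "\<lambda>k. e k * ?T k x" 1] by (simp add: add.commute)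
    then show "(\<Sum>k. e (Suc k) * ?T (Suc k) x) \<le> Rubio M \<Q> A h x"
      by simp
  qed simp
  finally show ?thesis .
qed

text \<open>Jensen with weights \<open>(1 / 2) ^ Suc k\<close> stands in for the triangle inequality
  and yields the factor 2 in norm.\<close>

lemma Rubio_bound:
  assumes [measurable]: "h \<in> borel_measurable M" "u \<in> borel_measurable M"
    and A: "1 \<le> A" and q: "1 < q"
    and bound: "\<And>f. f \<in> borel_measurable M \<Longrightarrow>
      (\<integral>\<^sup>+x. maximal M \<Q> f x powe q * u x \<partial>M) \<le> ennreal A * (\<integral>\<^sup>+x. f x powe q * u x \<partial>M)"
  shows "(\<integral>\<^sup>+x. Rubio M \<Q> A h x powe q * u x \<partial>M) \<le> ennreal (2 powr q) * (\<integral>\<^sup>+x. h x powe q * u x \<partial>M)"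
proof -
  let ?T = "\<lambda>k. (maximal M \<Q> ^^ k) h"
  define H where "H = (\<integral>\<^sup>+x. h x powe q * u x \<partial>M)"
  have iter: "(\<integral>\<^sup>+x. ?T k x powe q * u x \<partial>M) \<le> ennreal (A ^ k) * H" for k
  proof (induction k)
    case (Suc k)
    have "(\<integral>\<^sup>+x. ?T (Suc k) x powe q * u x \<partial>M) \<le> ennreal A * (\<integral>\<^sup>+x. ?T k x powe q * u x \<partial>M)"
      using bound[of "?T k"] by simp
    also have "\<dots> \<le> ennreal A * (ennreal (A ^ k) * H)"
      by (intro mult_left_mono Suc) simp
    also have "\<dots> = ennreal (A ^ Suc k) * H"
      using A by (simp add: ennreal_mult mult.assoc)
    finally show ?case .
  qed (simp add: H_def)
  define v :: "nat \<Rightarrow> ennreal" where "v k = ennreal ((1 / 2) ^ Suc k)" for k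
  have v: "(\<Sum>k. v k) = 1"
    unfolding v_def using sums_unique[OF power_half_series] power_half_series
    by (subst suminf_ennreal2) (auto simp: sums_iff)
  \<comment> \<open>The quotient of the series coefficient by the Jensen weight. Its
    \<open>q\<close>-th power is at most \<open>2 powr q / A ^ k\<close>, which cancels the
    \<open>A ^ k\<close> from iterating \<open>bound\<close>.\<close>
  define c where "c k = 2 / A ^ k" for k
  have c: "ennreal ((1 / (2 * A)) ^ k) = v k * ennreal (c k)" "0 < c k"
      "(c k) powr q \<le> 2 powr q / A ^ k" for k
  proof -
    have Ak: "1 \<le> A ^ k" using A by simp
    show "0 < c k" using A by (simp add: c_def)
    have "(1 / (2 * A)) ^ k = (1 / 2) ^ Suc k * c k"
      by (simp add: c_def power_divide power_mult_distrib)
    moreover have "v k * ennreal (c k) = ennreal ((1 / 2) ^ Suc k * c k)"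
      using \<open>0 < c k\<close> unfolding v_def by (subst ennreal_mult) auto
    ultimately show "ennreal ((1 / (2 * A)) ^ k) = v k * ennreal (c k)"
      by (simp only:)
    have "(A ^ k) powr 1 \<le> (A ^ k) powr q" using Ak q by (intro powr_mono) auto
    then have "A ^ k \<le> (A ^ k) powr q" using Ak by (subst (asm) powr_one) auto
    then have "2 powr q / (A ^ k) powr q \<le> 2 powr q / A ^ k"
      using Ak A by (intro divide_left_mono) (auto intro!: mult_pos_pos)
    then show "(c k) powr q \<le> 2 powr q / A ^ k"
      using Ak by (simp add: c_def powr_divide)
  qed
  have pt: "Rubio M \<Q> A h x powe q \<le> (\<Sum>k. v k * ennreal (2 powr q / A ^ k) * ?T k x powe q)" for x
  proof -
    have "Rubio M \<Q> A h x = (\<Sum>k. v k * (ennreal (c k) * ?T k x))"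
      unfolding Rubio_def by (simp add: c mult.assoc)
    then have "Rubio M \<Q> A h x powe q \<le> (\<Sum>k. v k * (ennreal (c k) * ?T k x) powe q)"
      using suminf_Jensen[OF v q] by simp
    also have "\<dots> \<le> (\<Sum>k. v k * ennreal (2 powr q / A ^ k) * ?T k x powe q)"
    proof (intro suminf_le)
      fix k
      have "(ennreal (c k) * ?T k x) powe q = ennreal (c k powr q) * ?T k x powe q"
        using q c(2)[of k] by (simp add: powe_mult powe_ennreal)
      also have "\<dots> \<le> ennreal (2 powr q / A ^ k) * ?T k x powe q"
        by (intro mult_right_mono ennreal_leI c) simp
      finally show "v k * (ennreal (c k) * ?T k x) powe q \<le> v k * ennreal (2 powr q / A ^ k) * ?T k x powe q"
        by (simp add: mult.assoc mult_left_mono)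
    qed auto
    finally show ?thesis .
  qed
  have "(\<integral>\<^sup>+x. Rubio M \<Q> A h x powe q * u x \<partial>M)
      \<le> (\<integral>\<^sup>+x. (\<Sum>k. v k * ennreal (2 powr q / A ^ k) * ?T k x powe q) * u x \<partial>M)"
    by (intro nn_integral_mono mult_right_mono pt) auto
  also have "\<dots> = (\<integral>\<^sup>+x. (\<Sum>k. v k * ennreal (2 powr q / A ^ k) * (?T k x powe q * u x)) \<partial>M)"
    by (simp add: mult.assoc flip: ennreal_suminf_multc)
  also have "\<dots> = (\<Sum>k. v k * ennreal (2 powr q / A ^ k) * (\<integral>\<^sup>+x. ?T k x powe q * u x \<partial>M))"
    by (subst nn_integral_suminf) (auto simp: nn_integral_cmult)
  also have "\<dots> \<le> (\<Sum>k. v k * (ennreal (2 powr q) * H))"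
  proof (intro suminf_le)
    fix k
    have "ennreal (2 powr q / A ^ k) * (\<integral>\<^sup>+x. ?T k x powe q * u x \<partial>M)
        \<le> ennreal (2 powr q / A ^ k) * (ennreal (A ^ k) * H)"
      by (intro mult_left_mono iter) simp
    also have "\<dots> = ennreal (2 powr q) * H"
      using A by (simp add: mult.assoc[symmetric] flip: ennreal_mult)
    finally show "v k * ennreal (2 powr q / A ^ k) * (\<integral>\<^sup>+x. ?T k x powe q * u x \<partial>M)
        \<le> v k * (ennreal (2 powr q) * H)"
      by (simp add: mult.assoc mult_left_mono)
  qed auto
  also have "\<dots> = ennreal (2 powr q) * H"
    by (simp add: v)
  finally show ?thesis by (simp add: H_def)
qed

end

section \<open>Positivity of the majorants\<close>

context doubling_family
begin

lemma countable_cover: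
  obtains \<C> where "\<C> \<subseteq> \<Q>" "countable \<C>" "\<C> \<noteq> {}" "AE x in M. x \<in> \<Union>\<C>"
proof -
  obtain \<C> where C: "\<C> \<subseteq> \<Q>" "countable \<C>" "\<Union>\<C> = \<Union>\<Q>"
    using Lindeloef[of \<Q>] by auto
  obtain Q where "Q \<in> \<Q>" using nonempty by auto
  with Q_pos[of Q] have "Q \<noteq> {}" by auto
  with \<open>Q \<in> \<Q>\<close> have "\<Union>\<Q> \<noteq> {}" by auto
  with C(3) have "\<C> \<noteq> {}" by force
  moreover have "AE x in M. x \<in> \<Union>\<C>" using cover by (simp only: C(3))
  ultimately show thesis using C that by metis
qed

text \<open>As countably many members cover almost everything, one of them carries positive mass of
  \<open>h\<close>. By \<open>joint\<close>, every point of the union of the family shares a larger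
  member with it.\<close>

lemma maximal_pos:
  assumes [measurable]: "h \<in> borel_measurable M" and "\<not> (AE x in M. h x = 0)"
  shows "AE x in M. 0 < maximal M \<Q> h x"
proof -
  obtain \<C> where C: "\<C> \<subseteq> \<Q>" "countable \<C>" "AE x in M. x \<in> \<Union>\<C>"
    using countable_cover by metis
  have "\<exists>P\<in>\<C>. 0 < (\<integral>\<^sup>+x\<in>P. h x \<partial>M)"
  proof (rule ccontr)
    assume *: "\<not> ?thesis"
    have "AE x in M. h x * indicator P x = 0" if "P \<in> \<C>" for P
    proof -
      have [measurable]: "P \<in> sets M" using that C by auto
      have "(\<integral>\<^sup>+x\<in>P. h x \<partial>M) = 0" using * that by auto
      then show ?thesis by (simp add: nn_integral_0_iff_AE)
    qed
    then have "AE x in M. \<forall>P\<in>\<C>. h x * indicator P x = 0"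
      using C(2) AE_ball_countable[of \<C> "\<lambda>x P. h x * indicator P x = 0" M] by blast
    with C(3) have "AE x in M. h x = 0"
      by eventually_elim (auto simp: indicator_def split: if_splits)
    with assms show False by simp
  qed
  then obtain P where P: "P \<in> \<Q>" "0 < (\<integral>\<^sup>+x\<in>P. h x \<partial>M)" using C by auto
  from cover show ?thesis
  proof eventually_elim
    case (elim x)
    then obtain Q where Q: "Q \<in> \<Q>" "x \<in> Q" by auto
    then obtain R where R: "R \<in> \<Q>" "P \<subseteq> R" "Q \<subseteq> R" using joint P by meson
    have "(\<integral>\<^sup>+x\<in>P. h x \<partial>M) \<le> (\<integral>\<^sup>+x\<in>R. h x \<partial>M)"
      using R by (intro nn_integral_mono) (auto simp: indicator_def)
    then have "0 < average M R h"
      using P R Q_finite by (auto simp: average_def ennreal_zero_less_divide intro: less_le_trans)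
    also have "\<dots> \<le> maximal M \<Q> h x" using R Q by (intro average_le_maximal) auto
    finally show ?case .
  qed
qed

text \<open>The term \<open>k = 1\<close> is used, since \<open>h\<close> itself, the term
  \<open>k = 0\<close>, may vanish on a large set.\<close>

lemma Rubio_pos:
  assumes "h \<in> borel_measurable M" "\<not> (AE x in M. h x = 0)" "1 \<le> A"
  shows "AE x in M. 0 < Rubio M \<Q> A h x"
  using maximal_pos[OF assms(1,2)]
proof eventually_elim
  case (elim x)
  have "0 < ennreal ((1 / (2 * A)) ^ 1) * (maximal M \<Q> ^^ 1) h x"
    using elim assms(3) by (simp add: ennreal_zero_less_mult_iff)
  also have "\<dots> \<le> Rubio M \<Q> A h x" by (rule Rubio_ge_term)
  finally show ?case .
qed

end

lemma AE_finite_of_integral: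
  assumes [measurable]: "h \<in> borel_measurable M" "u \<in> borel_measurable M"
    and "AE x in M. 0 < u x" and q: "0 < q" and "(\<integral>\<^sup>+x. h x powe q * u x \<partial>M) < top"
  shows "AE x in M. h x < top"
proof -
  have "AE x in M. h x powe q * u x \<noteq> \<infinity>"
    by (rule nn_integral_noteq_infinite) (use assms in auto)
  with assms(3) show ?thesis
  proof eventually_elim
    case (elim x)
    then show ?case using q powe_top(1)[of q]
      by (cases "h x = top") (auto simp: ennreal_mult_eq_top_iff less_top)
  qed
qed

text \<open>The A_1-condition bounds a function from below on \<open>Q\<close> by its average there,
  up to a constant. Negative powers turn this into upper bounds, for \<open>G\<close> in the average
  of \<open>w\<close> and for \<open>V\<close> in the dual average, and then all averages
  cancel.\<close>

lemma (in doubling_family) reverse_factorization: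
  assumes [measurable]: "G \<in> borel_measurable M" "V \<in> borel_measurable M"
    and G: "AE x in M. 0 < G x \<and> G x < top" and V: "AE x in M. 0 < V x \<and> V x < top"
    and GA: "\<And>Q x. Q \<in> \<Q> \<Longrightarrow> x \<in> Q \<Longrightarrow> average M Q G \<le> ennreal a * G x"
    and VA: "\<And>Q x. Q \<in> \<Q> \<Longrightarrow> x \<in> Q \<Longrightarrow> average M Q V \<le> ennreal b * V x"
    and ab: "0 < a" "0 < b" and p: "1 < p"
  defines "w \<equiv> \<lambda>x. G x powe (1 - p) * V x"
  shows "weight M \<Q> w" "Ap_bound M \<Q> p w (a powr (p - 1) * b)"
proof -
  have [measurable]: "w \<in> borel_measurable M" unfolding w_def by measurable
  have w_pos: "AE x in M. 0 < w x \<and> w x < \<infinity>"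
    using G V
  proof eventually_elim
    case (elim x)
    then show ?case using powe_pos_finite[of "G x" "1 - p"]
      by (auto simp: w_def ennreal_zero_less_mult_iff ennreal_mult_less_top)
  qed
  \<comment> \<open>Needed for that cancellation. Finiteness comes from the A_1-condition at a point
    of \<open>Q\<close> where \<open>U\<close> is finite.\<close>
  have avg_pos_finite: "0 < average M Q U \<and> average M Q U < top"
    if [measurable]: "U \<in> borel_measurable M" and U: "AE x in M. 0 < U x \<and> U x < top"
      and UA: "\<And>x. x \<in> Q \<Longrightarrow> average M Q U \<le> ennreal c * U x" and Q: "Q \<in> \<Q>" for U Q c
  proof -
    have "0 < average M Q U"
      using set_nn_integral_pos[of U Q] U Q Q_finite[OF Q]
      by (auto simp: average_def ennreal_zero_less_divide)
    moreover have "\<exists>x\<in>Q. U x < top"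
    proof (rule ccontr)
      assume "\<not> ?thesis"
      with U have "AE x in M. x \<notin> Q" by auto
      then show False using Q_pos[OF Q] Q_sets[OF Q] by (simp add: AE_iff_null_sets null_setsD1)
    qed
    then obtain x where "x \<in> Q" "U x < top" by auto
    then have "average M Q U < top"
      by (intro le_less_trans[OF UA]) (auto simp: ennreal_mult_less_top)
    ultimately show ?thesis by simp
  qed
  have main: "average M Q w < top \<and>
      average M Q w * average M Q (\<lambda>x. w x powe (- 1 / (p - 1))) powe (p - 1) \<le> ennreal (a powr (p - 1) * b)"
    if Q: "Q \<in> \<Q>" for Q
  proof -
    have [measurable]: "Q \<in> sets M" using Q by simp
    define g v where "g = average M Q G / ennreal a" and "v = average M Q V / ennreal b"
    have gv: "0 < g" "g < top" "0 < v" "v < top"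
      using avg_pos_finite[OF _ G GA[OF Q] Q] avg_pos_finite[OF _ V VA[OF Q] Q] ab
      by (auto simp: g_def v_def ennreal_zero_less_divide ennreal_divide_eq_top_iff less_top[symmetric])
    have avgG: "average M Q G = ennreal a * g" and avgV: "average M Q V = ennreal b * v"
      using ab by (simp_all add: g_def v_def mult_divide_cancel_ennreal)
    have gle: "g \<le> G x" if "x \<in> Q" for x
      using GA[OF Q that] ab unfolding avgG by (subst (asm) ennreal_mult_le_mult_iff) auto
    have vle: "v \<le> V x" if "x \<in> Q" for x
      using VA[OF Q that] ab unfolding avgV by (subst (asm) ennreal_mult_le_mult_iff) auto
    have mono: "average M Q f \<le> c * average M Q h"
      if [measurable]: "h \<in> borel_measurable M" and le: "AE x in M. x \<in> Q \<longrightarrow> f x \<le> c * h x" for f h c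
    proof -
      have "(\<integral>\<^sup>+x\<in>Q. f x \<partial>M) \<le> (\<integral>\<^sup>+x. c * (h x * indicator Q x) \<partial>M)"
        using le by (intro nn_integral_mono_AE) (auto simp: indicator_def)
      then show ?thesis unfolding average_def
        by (simp add: nn_integral_cmult ennreal_times_divide divide_right_mono_ennreal)
    qed
    have 1: "average M Q w \<le> g powe (1 - p) * (ennreal b * v)"
      unfolding avgV[symmetric] w_def using p gle
      by (intro mono) (auto intro!: mult_right_mono powe_antimono)
    have "average M Q (\<lambda>x. w x powe (- 1 / (p - 1))) \<le> v powe (- 1 / (p - 1)) * (ennreal a * g)"
      unfolding avgG[symmetric]
    proof (rule mono)
      show "AE x in M. x \<in> Q \<longrightarrow> w x powe (- 1 / (p - 1)) \<le> v powe (- 1 / (p - 1)) * G x"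
        using G V
      proof eventually_elim
        case (elim x)
        \<comment> \<open>The exponent \<open>1 - p\<close> on \<open>G\<close> is designed so that
          the dual power of \<open>w\<close> contains \<open>G\<close> to the first power.\<close>
        have "(1 - p) * (- 1 / (p - 1)) = 1" using p by (simp add: field_simps)
        then have "w x powe (- 1 / (p - 1)) = G x * V x powe (- 1 / (p - 1))"
          using elim unfolding w_def
          by (subst powe_mult_pos) (auto simp: powe_powe powe_pos_finite)
        then show ?case
          using vle[of x] p by (auto simp: mult.commute intro!: mult_left_mono powe_antimono)
      qed
    qed simp
    then have "average M Q (\<lambda>x. w x powe (- 1 / (p - 1))) powe (p - 1)
        \<le> (v powe (- 1 / (p - 1)) * (ennreal a * g)) powe (p - 1)"
      using p by (intro powe_mono) auto
    also have "\<dots> = v powe (- 1) * (ennreal (a powr (p - 1)) * g powe (p - 1))"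
      using p ab by (simp add: powe_mult powe_powe powe_ennreal)
    finally have 2: "average M Q (\<lambda>x. w x powe (- 1 / (p - 1))) powe (p - 1)
        \<le> v powe (- 1) * (ennreal (a powr (p - 1)) * g powe (p - 1))" .
    have "average M Q w * average M Q (\<lambda>x. w x powe (- 1 / (p - 1))) powe (p - 1)
        \<le> g powe (1 - p) * (ennreal b * v) * (v powe (- 1) * (ennreal (a powr (p - 1)) * g powe (p - 1)))"
      by (intro mult_mono 1 2) auto
    also have "\<dots> = (g powe (1 - p) * g powe (p - 1)) * (v * v powe (- 1)) * (ennreal b * ennreal (a powr (p - 1)))"
      by (simp only: mult_ac)
    also have "g powe (1 - p) * g powe (p - 1) = 1"
      using gv by (subst powe_add[symmetric]) auto
    also have "v * v powe (- 1) = 1"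
      using powe_add[of v 1 "- 1"] gv by simp
    also have "1 * 1 * (ennreal b * ennreal (a powr (p - 1))) = ennreal (a powr (p - 1) * b)"
      using ab by (simp add: mult.commute flip: ennreal_mult)
    finally have "average M Q w * average M Q (\<lambda>x. w x powe (- 1 / (p - 1))) powe (p - 1) \<le> ennreal (a powr (p - 1) * b)" .
    moreover have "average M Q w < top"
      using powe_pos_finite[of g "1 - p"] gv by (intro le_less_trans[OF 1]) (auto simp: ennreal_mult_less_top)
    ultimately show ?thesis by simp
  qed
  show "weight M \<Q> w" using w_pos main by (auto simp: weight_def)
  show "Ap_bound M \<Q> p w (a powr (p - 1) * b)" using main by (auto simp: Ap_bound_def)
qed

section \<open>Extrapolation\<close>

context weight_pair
begin

lemma extrapolation_finite:
  fixes f g :: "'a \<Rightarrow> ennreal" and A B p :: real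
  assumes [measurable]: "f \<in> borel_measurable M" "g \<in> borel_measurable M"
    and A: "1 \<le> A" "Muckenhoupt_const q K N \<le> ennreal A"
    and B: "1 \<le> B" "Muckenhoupt_const (q / (q - 1)) (K powe (1 / (q - 1))) N \<le> ennreal B"
    and p: "1 < p"
    and hyp: "\<And>v. weight M \<Q> v \<Longrightarrow> Ap_bound M \<Q> p v ((2 * A) powr (p - 1) * (2 * B)) \<Longrightarrow>
      (\<integral>\<^sup>+x. f x powe p * v x \<partial>M) \<le> (\<integral>\<^sup>+x. g x powe p * v x \<partial>M)"
    and f_fin: "(\<integral>\<^sup>+x. f x powe q * w x \<partial>M) < top"
    and f_nz: "\<not> (AE x in M. f x = 0)"
    and g_fin: "(\<integral>\<^sup>+x. g x powe q * w x \<partial>M) < top"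
    and g_nz: "\<not> (AE x in M. g x = 0)"
  shows "(\<integral>\<^sup>+x. f x powe q * w x \<partial>M) \<le> ennreal (4 powr q) * (\<integral>\<^sup>+x. g x powe q * w x \<partial>M)"
proof -
  define q' where "q' = q / (q - 1)"
  have q': "1 < q'" "(q - 1) * q' = q" "1 / q' = 1 - 1 / q"
    using q by (auto simp: q'_def field_simps)
  interpret dual: weight_pair M \<Q> sz N s w q' "K powe (1 / (q - 1))"
    unfolding q'_def by (rule dual)
  define J where "J = (\<integral>\<^sup>+x. f x powe q * w x \<partial>M)"
  define L where "L = (\<integral>\<^sup>+x. g x powe q * w x \<partial>M)"
  \<comment> \<open>The dual extremiser: \<open>f x * h x\<close> is the integrand of
    \<open>J\<close>, and \<open>h_int\<close> shows that \<open>h\<close> has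
    \<open>q'\<close>-integral \<open>J\<close> against \<open>s\<close>.\<close>
  define h where "h x = f x powe (q - 1) * w x" for x
  have [measurable]: "h \<in> borel_measurable M" unfolding h_def by measurable
  define G where "G = Rubio M \<Q> A g"
  define V where "V = Rubio M \<Q> B h"
  have [measurable]: "G \<in> borel_measurable M" "V \<in> borel_measurable M"
    unfolding G_def V_def by measurable
  have gG: "g x \<le> G x" and hV: "h x \<le> V x" for x
    unfolding G_def V_def by (rule Rubio_ge)+
  have AE_w: "AE x in M. 0 < w x" and AE_s: "AE x in M. 0 < s x"
    using w_pos s_pos by auto
  have h_int: "(\<integral>\<^sup>+x. h x powe q' * s x \<partial>M) = J"
    unfolding J_def
  proof (intro nn_integral_cong_AE)
    show "AE x in M. h x powe q' * s x = f x powe q * w x"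
      using w_pos s_eq
    proof eventually_elim
      case (elim x)
      have "q' + - 1 / (q - 1) = (q - 1) / (q - 1)"
        unfolding q'_def add_divide_distrib[symmetric] by simp
      then have "q' + - 1 / (q - 1) = 1" using q by simp
      then have "w x powe q' * s x = w x"
        using powe_add[of "w x" q' "- 1 / (q - 1)"] elim by simp
      moreover have "h x powe q' = f x powe q * w x powe q'"
        unfolding h_def using q' by (simp add: powe_mult powe_powe)
      ultimately show ?case by (simp add: mult.assoc)
    qed
  qed
  have G_int: "(\<integral>\<^sup>+x. G x powe q * w x \<partial>M) \<le> ennreal (2 powr q) * L"
    unfolding G_def L_def
    by (intro Rubio_bound A q order_trans[OF maximal_weighted_bound] mult_right_mono) auto
  have V_int: "(\<integral>\<^sup>+x. V x powe q' * s x \<partial>M) \<le> ennreal (2 powr q') * J"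
    unfolding V_def h_int[symmetric]
    using B(2) by (intro Rubio_bound B(1) q' order_trans[OF dual.maximal_weighted_bound] mult_right_mono)
      (auto simp: q'_def)
  have G: "AE x in M. 0 < G x \<and> G x < top"
  proof -
    have "AE x in M. 0 < G x" unfolding G_def using g_nz A by (intro Rubio_pos) auto
    moreover have "(\<integral>\<^sup>+x. G x powe q * w x \<partial>M) < top"
      using g_fin by (intro le_less_trans[OF G_int]) (simp add: ennreal_mult_less_top L_def)
    then have "AE x in M. G x < top" using AE_w q by (intro AE_finite_of_integral[of G M w q]) auto
    ultimately show ?thesis by auto
  qed
  have V: "AE x in M. 0 < V x \<and> V x < top"
  proof -
    have "\<not> (AE x in M. h x = 0)"
    proof
      assume "AE x in M. h x = 0"
      with w_pos have "AE x in M. f x = 0"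
        by eventually_elim (use q in \<open>auto simp: h_def powe_eq_0_iff\<close>)
      with f_nz show False by simp
    qed
    then have "AE x in M. 0 < V x" unfolding V_def using B by (intro Rubio_pos) auto
    moreover have "(\<integral>\<^sup>+x. V x powe q' * s x \<partial>M) < top"
      using f_fin by (intro le_less_trans[OF V_int]) (simp add: ennreal_mult_less_top J_def)
    then have "AE x in M. V x < top" using AE_s q' by (intro AE_finite_of_integral[of V M s q']) auto
    ultimately show ?thesis by auto
  qed
  define v where "v x = G x powe (1 - p) * V x" for x
  have [measurable]: "v \<in> borel_measurable M" unfolding v_def by measurable
  have GA: "average M Q G \<le> ennreal (2 * A) * G x" if "Q \<in> \<Q>" "x \<in> Q" for Q x
    unfolding G_def using that A by (intro average_Rubio_le) auto
  have VB: "average M Q V \<le> ennreal (2 * B) * V x" if "Q \<in> \<Q>" "x \<in> Q" for Q x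
    unfolding V_def using that B by (intro average_Rubio_le) auto
  have AB: "0 < 2 * A" "0 < 2 * B" using A B by auto
  have "weight M \<Q> v"
    unfolding v_def by (rule reverse_factorization(1)[OF _ _ G V GA VB AB p]) auto
  moreover have "Ap_bound M \<Q> p v ((2 * A) powr (p - 1) * (2 * B))"
    unfolding v_def by (rule reverse_factorization(2)[OF _ _ G V GA VB AB p]) auto
  ultimately have fg: "(\<integral>\<^sup>+x. f x powe p * v x \<partial>M) \<le> (\<integral>\<^sup>+x. g x powe p * v x \<partial>M)" by (rule hyp)
  have t: "0 < 1 / p" "1 / p < 1" "0 < 1 / q" "1 / q < 1" using p q by auto
  define I where "I = (\<integral>\<^sup>+x. G x * V x \<partial>M)"
  have "J \<le> (\<integral>\<^sup>+x. f x * V x \<partial>M)"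
    unfolding J_def
  proof (intro nn_integral_mono)
    fix x
    have "f x powe q * w x = f x * h x"
      using powe_add[of "f x" 1 "q - 1"] q by (simp add: h_def mult.assoc)
    also have "\<dots> \<le> f x * V x" by (intro mult_left_mono hV) simp
    finally show "f x powe q * w x \<le> f x * V x" .
  qed
  \<comment> \<open>The powers of \<open>G\<close> cancel between \<open>v\<close> and the second
    factor, leaving \<open>f * V\<close>.\<close>
  also have "\<dots> = (\<integral>\<^sup>+x. (f x powe p * v x) powe (1 / p) * (G x * V x) powe (1 - 1 / p) \<partial>M)"
  proof (intro nn_integral_cong_AE)
    show "AE x in M. f x * V x = (f x powe p * v x) powe (1 / p) * (G x * V x) powe (1 - 1 / p)"
      using G
    proof eventually_elim
      case (elim x)
      have e: "(1 - p) * (1 / p) + (1 - 1 / p) = 0" using p by (simp add: field_simps)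
      have "(f x powe p * v x) powe (1 / p) * (G x * V x) powe (1 - 1 / p)
          = f x * (G x powe ((1 - p) * (1 / p)) * G x powe (1 - 1 / p)) * (V x powe (1 / p) * V x powe (1 - 1 / p))"
        unfolding v_def using t p by (simp add: powe_mult powe_powe mult_ac)
      also have "G x powe ((1 - p) * (1 / p)) * G x powe (1 - 1 / p) = 1"
        using powe_add[of "G x" "(1 - p) * (1 / p)" "1 - 1 / p"] elim unfolding e by simp
      also have "V x powe (1 / p) * V x powe (1 - 1 / p) = V x"
        using powe_add[of "V x" "1 / p" "1 - 1 / p"] t by simp
      finally show ?case by simp
    qed
  qed
  also have "\<dots> \<le> (\<integral>\<^sup>+x. f x powe p * v x \<partial>M) powe (1 / p) * I powe (1 - 1 / p)"
    unfolding I_def by (intro nn_integral_Hoelder t) measurable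
  \<comment> \<open>Here the hypothesis for exponent \<open>p\<close> enters. As
    \<open>g \<le> G\<close>, the integral of \<open>g powe p * v\<close> is at most that of
    \<open>G powe p * v = G * V\<close>, so both Hoelder factors are powers of
    \<open>I\<close>.\<close>
  also have "\<dots> \<le> I powe (1 / p) * I powe (1 - 1 / p)"
  proof (intro mult_right_mono powe_mono)
    have "(\<integral>\<^sup>+x. g x powe p * v x \<partial>M) \<le> I"
      unfolding I_def
    proof (intro nn_integral_mono_AE)
      show "AE x in M. g x powe p * v x \<le> G x * V x"
        using G
      proof eventually_elim
        case (elim x)
        have "g x powe p * v x \<le> G x powe p * v x"
          using p gG by (intro mult_right_mono powe_mono) auto
        also have "\<dots> = G x * V x"
          using powe_add[of "G x" p "1 - p"] elim by (simp add: v_def mult.assoc[symmetric])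
        finally show ?case .
      qed
    qed
    with fg show "(\<integral>\<^sup>+x. f x powe p * v x \<partial>M) \<le> I" by simp
  qed (use p in auto)
  also have "\<dots> = I"
    using powe_add[of I "1 / p" "1 - 1 / p"] t by simp
  \<comment> \<open>Duality between \<open>L_q(w)\<close> and \<open>L_q'(s)\<close>: the powers of
    \<open>w\<close> and \<open>s\<close> multiply to 1 almost everywhere.\<close>
  also have "I = (\<integral>\<^sup>+x. (G x powe q * w x) powe (1 / q) * (V x powe q' * s x) powe (1 - 1 / q) \<partial>M)"
    unfolding I_def
  proof (intro nn_integral_cong_AE)
    show "AE x in M. G x * V x = (G x powe q * w x) powe (1 / q) * (V x powe q' * s x) powe (1 - 1 / q)"
      using w_pos s_eq
    proof eventually_elim
      case (elim x)
      have e: "- 1 / (q - 1) * (1 - 1 / q) = - (1 / q)" using q by (simp add: field_simps)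
      have e': "q' * (1 - 1 / q) = 1" using q' by (simp add: q'(3)[symmetric])
      have "w x powe (1 / q) * s x powe (1 - 1 / q) = w x powe (1 / q + - (1 / q))"
        using elim by (subst powe_add) (auto simp: powe_powe simp flip: e)
      moreover have "(G x powe q * w x) powe (1 / q) * (V x powe q' * s x) powe (1 - 1 / q)
          = G x * V x * (w x powe (1 / q) * s x powe (1 - 1 / q))"
        using t q e' by (simp add: powe_mult powe_powe mult_ac)
      ultimately show ?case by simp
    qed
  qed
  also have "\<dots> \<le> (\<integral>\<^sup>+x. G x powe q * w x \<partial>M) powe (1 / q) * (\<integral>\<^sup>+x. V x powe q' * s x \<partial>M) powe (1 - 1 / q)"
    by (intro nn_integral_Hoelder t) measurable
  also have "\<dots> \<le> (ennreal (2 powr q) * L) powe (1 / q) * (ennreal (2 powr q') * J) powe (1 - 1 / q)"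
    using t by (intro mult_mono powe_mono G_int V_int) auto
  also have "\<dots> = 4 * L powe (1 / q) * J powe (1 - 1 / q)"
  proof -
    have "ennreal (2 powr q) powe (1 / q) = 2"
      using q by (simp add: powe_ennreal powr_powr)
    moreover have "ennreal (2 powr q') powe (1 - 1 / q) = 2"
      unfolding q'(3)[symmetric] using q'(1) by (simp add: powe_ennreal powr_powr)
    ultimately show ?thesis
      using t by (simp add: powe_mult mult_ac)
  qed
  finally have JL: "J \<le> 4 * L powe (1 / q) * J powe (1 - 1 / q)" .
  have J: "0 < J" "J < top"
  proof -
    show "J < top" using f_fin by (simp add: J_def)
    have "J \<noteq> 0"
    proof
      assume "J = 0"
      then have "AE x in M. f x powe q * w x = 0" by (simp add: J_def nn_integral_0_iff_AE)
      with w_pos have "AE x in M. f x = 0"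
        by eventually_elim (use q in \<open>auto simp: powe_eq_0_iff\<close>)
      with f_nz show False by simp
    qed
    then show "0 < J" by (simp add: zero_less_iff_neq_zero)
  qed
  \<comment> \<open>\<open>J\<close> is split so that its power \<open>1 - 1 / q\<close>, positive
    and finite, can be cancelled.\<close>
  have "J powe (1 - 1 / q) * J powe (1 / q) \<le> J powe (1 - 1 / q) * (4 * L powe (1 / q))"
    using JL powe_add[of J "1 - 1 / q" "1 / q"] J by (simp add: mult_ac)
  then have "J powe (1 / q) \<le> 4 * L powe (1 / q)"
    using powe_pos_finite[OF J, of "1 - 1 / q"] by (subst (asm) ennreal_mult_le_mult_iff) auto
  then have "(J powe (1 / q)) powe q \<le> (4 * L powe (1 / q)) powe q"
    using q by (intro powe_mono) auto
  moreover have "(4 * L powe (1 / q)) powe q = ennreal (4 powr q) * L"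
    using q powe_ennreal[of 4 q] by (simp add: powe_mult powe_powe)
  ultimately show ?thesis
    using q unfolding J_def[symmetric] L_def[symmetric] by (simp add: powe_powe)
qed

text \<open>An infinite right side is trivial, and a vanishing \<open>g\<close> forces
  \<open>f\<close> to vanish. Otherwise \<open>f\<close> is truncated, which preserves the
  hypothesis because it only lowers the left side, and monotone convergence removes the
  truncation.\<close>

lemma extrapolation:
  fixes f g :: "'a \<Rightarrow> ennreal" and A B p :: real
  assumes [measurable]: "f \<in> borel_measurable M" "g \<in> borel_measurable M"
    and f_finite: "AE x in M. f x < top"
    and A: "1 \<le> A" "Muckenhoupt_const q K N \<le> ennreal A"
    and B: "1 \<le> B" "Muckenhoupt_const (q / (q - 1)) (K powe (1 / (q - 1))) N \<le> ennreal B"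
    and p: "1 < p"
    and hyp: "\<And>v. weight M \<Q> v \<Longrightarrow> Ap_bound M \<Q> p v ((2 * A) powr (p - 1) * (2 * B)) \<Longrightarrow>
      (\<integral>\<^sup>+x. f x powe p * v x \<partial>M) \<le> (\<integral>\<^sup>+x. g x powe p * v x \<partial>M)"
  shows "(\<integral>\<^sup>+x. f x powe q * w x \<partial>M) \<le> ennreal (4 powr q) * (\<integral>\<^sup>+x. g x powe q * w x \<partial>M)"
proof (cases "(\<integral>\<^sup>+x. g x powe q * w x \<partial>M) = top")
  case True
  then show ?thesis by (simp add: ennreal_mult_top)
next
  case g_fin: False
  show ?thesis
  proof (cases "AE x in M. g x = 0")
    case True
    \<comment> \<open>The constant weight 1 has A_p-constant 1, so the hypothesis applies to it and
      gives \<open>f = 0\<close> almost everywhere.\<close>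
    have avg1: "average M Q (\<lambda>x. 1) = 1" if "Q \<in> \<Q>" for Q
      using Q_pos[OF that] Q_finite[OF that] that by (simp add: average_def)
    have "1 \<le> (2 * A) powr (p - 1)" using A p by (intro ge_one_powr_ge_zero) auto
    then have "1 * 1 \<le> (2 * A) powr (p - 1) * (2 * B)" using B by (intro mult_mono) auto
    then have "1 \<le> ennreal ((2 * A) powr (p - 1) * (2 * B))"
      using ennreal_leI by fastforce
    then have "Ap_bound M \<Q> p (\<lambda>x. 1) ((2 * A) powr (p - 1) * (2 * B))"
      by (simp add: Ap_bound_def avg1)
    moreover have "weight M \<Q> (\<lambda>x. 1)" by (auto simp: weight_def avg1)
    ultimately have "(\<integral>\<^sup>+x. f x powe p * 1 \<partial>M) \<le> (\<integral>\<^sup>+x. g x powe p * 1 \<partial>M)"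
      by (rule hyp[rotated])
    also have "\<dots> = 0"
      using True p by (subst nn_integral_0_iff_AE) auto
    finally have "AE x in M. f x powe p = 0" by (simp add: nn_integral_0_iff_AE)
    then have "AE x in M. f x powe q * w x = 0"
      by eventually_elim (use p q in \<open>auto simp: powe_eq_0_iff\<close>)
    then have "(\<integral>\<^sup>+x. f x powe q * w x \<partial>M) = 0" by (subst nn_integral_0_iff_AE) auto
    then show ?thesis by simp
  next
    case g_nz: False
    obtain \<C> where C: "\<C> \<subseteq> \<Q>" "countable \<C>" "\<C> \<noteq> {}" "AE x in M. x \<in> \<Union>\<C>"
      by (rule countable_cover)
    have mem: "from_nat_into \<C> i \<in> \<Q>" for i using from_nat_into[OF C(3)] C(1) by auto
    \<comment> \<open>On \<open>S n\<close> the function \<open>f\<close> is bounded, and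
      \<open>S n\<close> lies in finitely many members, each of finite \<open>w\<close>-mass; this
      makes the truncated integral finite.\<close>
    define S where "S n = {x\<in>space M. f x \<le> of_nat n} \<inter> (\<Union>i<n. from_nat_into \<C> i)" for n :: nat
    have S_sets [measurable]: "S n \<in> sets M" for n
      unfolding S_def using mem by (intro sets.Int sets.finite_UN) auto
    have truncated: "(\<integral>\<^sup>+x. (f x powe q * w x) * indicator (S n) x \<partial>M)
        \<le> ennreal (4 powr q) * (\<integral>\<^sup>+x. g x powe q * w x \<partial>M)" for n
    proof -
      define F where "F x = f x * indicator (S n) x" for x
      have [measurable]: "F \<in> borel_measurable M" unfolding F_def by measurable
      have F_eq: "F x powe q * w x = (f x powe q * w x) * indicator (S n) x" for x
        using q by (auto simp: F_def indicator_def)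
      show ?thesis
      proof (cases "AE x in M. F x = 0")
        case True
        then have "(\<integral>\<^sup>+x. F x powe q * w x \<partial>M) = 0"
          using q by (subst nn_integral_0_iff_AE) auto
        then show ?thesis by (simp add: F_eq)
      next
        case False
        have "(\<integral>\<^sup>+x. F x powe q * w x \<partial>M)
            \<le> (\<integral>\<^sup>+x. (\<Sum>i<n. of_nat n powe q * (w x * indicator (from_nat_into \<C> i) x)) \<partial>M)"
        proof (intro nn_integral_mono)
          fix x
          show "F x powe q * w x \<le> (\<Sum>i<n. of_nat n powe q * (w x * indicator (from_nat_into \<C> i) x))"
          proof (cases "x \<in> S n")
            case True
            then obtain i where i: "i < n" "x \<in> from_nat_into \<C> i" "f x \<le> of_nat n"
              by (auto simp: S_def)
            have "F x powe q * w x \<le> of_nat n powe q * (w x * indicator (from_nat_into \<C> i) x)"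
              using i True q by (simp add: F_eq) (intro mult_right_mono powe_mono; simp)
            also have "\<dots> \<le> (\<Sum>i<n. of_nat n powe q * (w x * indicator (from_nat_into \<C> i) x))"
              using i by (intro member_le_sum) auto
            finally show ?thesis .
          qed (simp add: F_eq)
        qed
        also have "\<dots> = (\<Sum>i<n. of_nat n powe q * (\<integral>\<^sup>+x\<in>from_nat_into \<C> i. w x \<partial>M))"
          using mem by (subst nn_integral_sum) (auto intro!: sum.cong nn_integral_cmult)
        also have "\<dots> < top"
          using w_finite[OF mem] q
          by (auto simp: ennreal_mult_less_top powe_less_top_iff of_nat_less_top)
        finally have F_fin: "(\<integral>\<^sup>+x. F x powe q * w x \<partial>M) < top" .
        have "(\<integral>\<^sup>+x. F x powe q * w x \<partial>M) \<le> ennreal (4 powr q) * (\<integral>\<^sup>+x. g x powe q * w x \<partial>M)"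
        proof (rule extrapolation_finite[OF _ _ A B p _ F_fin False _ g_nz])
          fix v assume v: "weight M \<Q> v" "Ap_bound M \<Q> p v ((2 * A) powr (p - 1) * (2 * B))"
          have "(\<integral>\<^sup>+x. F x powe p * v x \<partial>M) \<le> (\<integral>\<^sup>+x. f x powe p * v x \<partial>M)"
            using p by (intro nn_integral_mono mult_right_mono powe_mono) (auto simp: F_def indicator_def)
          also have "\<dots> \<le> (\<integral>\<^sup>+x. g x powe p * v x \<partial>M)" by (rule hyp[OF v])
          finally show "(\<integral>\<^sup>+x. F x powe p * v x \<partial>M) \<le> (\<integral>\<^sup>+x. g x powe p * v x \<partial>M)" .
        qed (use g_fin in \<open>auto simp: less_top\<close>)
        then show ?thesis by (simp add: F_eq)
      qed
    qed
    have "incseq S"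
    proof (intro incseq_SucI subsetI)
      fix n x assume "x \<in> S n"
      moreover have "(of_nat n :: ennreal) \<le> of_nat (Suc n)" by simp
      ultimately show "x \<in> S (Suc n)"
        by (auto simp: S_def lessThan_Suc intro: order_trans simp del: of_nat_Suc)
    qed
    have "AE x in M. x \<in> (\<Union>n. S n)"
      using f_finite C(4) AE_space
    proof eventually_elim
      case (elim x)
      then obtain m :: nat where m: "f x \<le> of_nat m"
        by (metis ennreal_Ex_less_of_nat less_imp_le)
      obtain i where i: "x \<in> from_nat_into \<C> i"
        using elim range_from_nat_into[OF C(3,2)] by blast
      \<comment> \<open>\<open>Suc i\<close>, because \<open>S n\<close> uses only the members with
        index strictly below \<open>n\<close>.\<close>
      have "(of_nat m :: ennreal) \<le> of_nat (max m (Suc i))" by simp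
      then have "x \<in> S (max m (Suc i))"
        unfolding S_def using m i elim by (auto intro: order_trans intro!: bexI[of _ i])
      then show ?case by blast
    qed
    then have "(\<integral>\<^sup>+x. f x powe q * w x \<partial>M)
        = (\<integral>\<^sup>+x. (f x powe q * w x) * indicator (\<Union>n. S n) x \<partial>M)"
      by (intro nn_integral_cong_AE) (auto elim!: eventually_mono simp: indicator_def)
    also have "\<dots> = emeasure (density M (\<lambda>x. f x powe q * w x)) (\<Union>n. S n)"
      by (subst emeasure_density) auto
    also have "\<dots> = (SUP n. emeasure (density M (\<lambda>x. f x powe q * w x)) (S n))"
      using \<open>incseq S\<close> by (intro SUP_emeasure_incseq[symmetric]) auto
    also have "\<dots> \<le> ennreal (4 powr q) * (\<integral>\<^sup>+x. g x powe q * w x \<partial>M)"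
      using truncated by (intro SUP_least) (simp add: emeasure_density)
    finally show ?thesis .
  qed
qed

end

section \<open>The least A_p-bound\<close>

context doubling_family
begin

text \<open>The bounds form a closed half-line because the supremum of the products is positive and
  finite. Were it 0, every negative real would be a bound as well and \<open>LEAST\<close> would
  have no meaning.\<close>

lemma Ap_bound_iff:
  assumes [measurable]: "w \<in> borel_measurable M" and w: "AE x in M. 0 < w x \<and> w x < top"
    and p: "1 < p" and ex: "\<exists>N. Ap_bound M \<Q> p w N"
  shows "\<exists>m. \<forall>N. Ap_bound M \<Q> p w N \<longleftrightarrow> m \<le> N"
proof -
  define c where "c Q = average M Q w *
        ennreal_powr (average M Q (\<lambda>x. ennreal_powr (w x) (- 1 / (p - 1)))) (p - 1)" for Q
  have iff: "Ap_bound M \<Q> p w N \<longleftrightarrow> (SUP Q\<in>\<Q>. c Q) \<le> ennreal N" for N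
    by (simp add: Ap_bound_def c_def SUP_le_iff)
  obtain Q where Q: "Q \<in> \<Q>" using nonempty by auto
  have avg: "0 < average M Q u" if [measurable]: "u \<in> borel_measurable M" and "AE x in M. 0 < u x" for u
    using set_nn_integral_pos[of u Q] that Q Q_finite[OF Q] by (auto simp: average_def ennreal_zero_less_divide)
  have "0 < c Q"
  proof -
    have "AE x in M. 0 < w x powe (- 1 / (p - 1))"
      using w by eventually_elim (metis powe_pos_finite)
    then have "0 < average M Q (\<lambda>x. w x powe (- 1 / (p - 1))) powe (p - 1)"
      using p avg[of "\<lambda>x. w x powe (- 1 / (p - 1))"] by (auto simp: zero_less_iff_neq_zero powe_eq_0_iff)
    then show ?thesis
      using avg[of w] w unfolding c_def by (auto simp: ennreal_zero_less_mult_iff)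
  qed
  also have "c Q \<le> (SUP Q\<in>\<Q>. c Q)" using Q by (rule SUP_upper)
  finally have pos: "0 < (SUP Q\<in>\<Q>. c Q)" .
  obtain N where "(SUP Q\<in>\<Q>. c Q) \<le> ennreal N" using ex iff by auto
  then have "(SUP Q\<in>\<Q>. c Q) < top" by (rule le_less_trans) simp
  then obtain m where m: "0 < m" "(SUP Q\<in>\<Q>. c Q) = ennreal m"
    using pos by (cases "SUP Q\<in>\<Q>. c Q" rule: ennreal_cases_pos) auto
  show ?thesis
    using m by (intro exI[of _ m]) (auto simp: iff ennreal_le_iff2)
qed

lemma Ap_const_le:
  assumes "weight M \<Q> w" "Ap_bound M \<Q> p w c" "1 < p"
  shows "w \<in> Ap_weights M \<Q> p" "Ap_const M \<Q> p w \<le> c"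
proof -
  show "w \<in> Ap_weights M \<Q> p" using assms by (auto simp: Ap_weights_def)
  obtain m where m: "\<And>c. Ap_bound M \<Q> p w c \<longleftrightarrow> m \<le> c"
    using Ap_bound_iff[of w p] assms by (auto simp: weight_def)
  then have "Ap_const M \<Q> p w = m" by (auto simp: Ap_const_def intro!: Least_equality)
  with m assms show "Ap_const M \<Q> p w \<le> c" by auto
qed

lemma Ap_bound_if_const_le:
  assumes "w \<in> Ap_weights M \<Q> p" "Ap_const M \<Q> p w \<le> c" "1 < p"
  shows "weight M \<Q> w" "Ap_bound M \<Q> p w c"
proof -
  show "weight M \<Q> w" using assms by (auto simp: Ap_weights_def)
  then obtain m where m: "\<And>c. Ap_bound M \<Q> p w c \<longleftrightarrow> m \<le> c"
    using Ap_bound_iff[of w p] assms by (auto simp: weight_def Ap_weights_def)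
  then have "Ap_const M \<Q> p w = m" by (auto simp: Ap_const_def intro!: Least_equality)
  with m assms show "Ap_bound M \<Q> p w c" by auto
qed

lemma weight_pairI:
  assumes "weight M \<Q> w" "Ap_bound M \<Q> q w N'" "1 < q"
  shows "weight_pair M \<Q> sz N w (\<lambda>x. w x powe (- 1 / (q - 1))) q (ennreal N')"
proof
  have [measurable]: "w \<in> borel_measurable M" using assms by (auto simp: weight_def)
  show "w \<in> borel_measurable M" "(\<lambda>x. w x powe (- 1 / (q - 1))) \<in> borel_measurable M" by measurable
  show "AE x in M. 0 < w x \<and> w x < top" using assms by (auto simp: weight_def)
  fix Q assume Q: "Q \<in> \<Q>"
  let ?s = "\<lambda>x. w x powe (- 1 / (q - 1))"
  show "(\<integral>\<^sup>+x\<in>Q. w x \<partial>M) < top"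
    using assms Q Q_finite[OF Q] by (auto simp: weight_def mult_average[OF Q, symmetric] ennreal_mult_less_top)
  have "(\<integral>\<^sup>+x\<in>Q. w x \<partial>M) * (\<integral>\<^sup>+x\<in>Q. ?s x \<partial>M) powe (q - 1)
      = emeasure M Q * emeasure M Q powe (q - 1) * (average M Q w * average M Q ?s powe (q - 1))"
    unfolding mult_average[OF Q, symmetric] using assms by (simp add: powe_mult mult_ac)
  also have "emeasure M Q * emeasure M Q powe (q - 1) = emeasure M Q powe q"
    using powe_add[of "emeasure M Q" 1 "q - 1"] assms by simp
  also have "emeasure M Q powe q * (average M Q w * average M Q ?s powe (q - 1))
      \<le> emeasure M Q powe q * ennreal N'"
    using assms Q by (intro mult_left_mono) (auto simp: Ap_bound_def)
  finally show "(\<integral>\<^sup>+x\<in>Q. w x \<partial>M) * (\<integral>\<^sup>+x\<in>Q. ?s x \<partial>M) powe (q - 1) \<le> ennreal N' * emeasure M Q powe q"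
    by (simp add: mult.commute)
qed (use assms in auto)

end

section \<open>Anisotropic boxes\<close>

locale box_space =
  fixes d :: nat and k :: "nat \<Rightarrow> nat" and I :: "nat \<Rightarrow> real set"
    and M :: "(nat \<Rightarrow> real) measure" and N\<^sub>0 :: real
  assumes doubling: "doubling_space d k I M N\<^sub>0"
begin

abbreviation "E \<equiv> topspace (Euclidean_space d)"

text \<open>The value is arbitrary when \<open>I j = UNIV\<close>; every use is guarded against that
  case.\<close>

definition lo :: "nat \<Rightarrow> real" where "lo j = (SOME a. I j = {a..})"

lemma I_eq: "j < d \<Longrightarrow> I j \<noteq> UNIV \<Longrightarrow> I j = {lo j..}"
  using doubling unfolding doubling_space_def lo_def by (metis (mono_tags, lifting) someI_ex)

lemma k_ge_1: "j < d \<Longrightarrow> 1 \<le> k j"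
  using doubling unfolding doubling_space_def by auto

lemma mem_I_iff: "j < d \<Longrightarrow> y \<in> I j \<longleftrightarrow> I j = UNIV \<or> lo j \<le> y"
  using I_eq by fastforce

lemma mem_E: "x \<in> E \<longleftrightarrow> (\<forall>i\<ge>d. x i = 0)"
  by (simp add: topspace_Euclidean_space)

lemma mem_domain: "x \<in> domain d I \<longleftrightarrow> x \<in> E \<and> (\<forall>j<d. I j = UNIV \<or> lo j \<le> x j)"
  by (auto simp: domain_def mem_I_iff)

lemma mem_centered_box:
  "y \<in> centered_box d k l x \<longleftrightarrow> y \<in> E \<and> (\<forall>j<d. \<bar>y j - x j\<bar> < l ^ k j / 2)"
proof -
  have "y j \<in> {x j - l ^ k j / 2 <..< x j + l ^ k j / 2} \<longleftrightarrow> \<bar>y j - x j\<bar> < l ^ k j / 2" for j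
    unfolding greaterThanLessThan_iff by arith
  then show ?thesis by (simp add: centered_box_def)
qed

text \<open>A coordinatewise form of lying inside the domain. Equality is allowed because boxes are
  open.\<close>

definition admissible :: "real \<Rightarrow> (nat \<Rightarrow> real) \<Rightarrow> bool" where
  "admissible l x \<longleftrightarrow> 0 < l \<and> x \<in> E \<and> (\<forall>j<d. I j = UNIV \<or> lo j + l ^ k j / 2 \<le> x j)"

lemma admissible_domain: "admissible l x \<Longrightarrow> x \<in> domain d I"
  unfolding admissible_def mem_domain
  by (metis add_increasing2 add_le_cancel_left divide_nonneg_nonneg order_trans
      zero_le_numeral zero_le_power less_imp_le le_add_same_cancel1)

text \<open>Strictness, due to the openness of boxes, is what \<open>in_shifted_box\<close>
  requires.\<close>

lemma interior_if_in_admissible: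
  assumes "admissible l x" "v \<in> centered_box d k l x" "j < d" "I j \<noteq> UNIV"
  shows "lo j < v j"
  using assms unfolding admissible_def mem_centered_box by (smt (verit) abs_less_iff)

lemma admissible_subset: "admissible l x \<Longrightarrow> centered_box d k l x \<subseteq> domain d I"
  using interior_if_in_admissible[of l x]
  by (fastforce simp: mem_domain mem_centered_box[of _ l x] less_imp_le)

lemma subset_admissible:
  assumes "x \<in> domain d I" "0 < l" "centered_box d k l x \<subseteq> domain d I"
  shows "admissible l x"
  unfolding admissible_def
proof (intro conjI allI impI)
  fix j assume j: "j < d"
  show "I j = UNIV \<or> lo j + l ^ k j / 2 \<le> x j"
  proof (rule ccontr)
    assume *: "\<not> ?thesis"
    \<comment> \<open>A point below \<open>lo j\<close> but still above the lower end of the box: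
      moving the centre there in coordinate \<open>j\<close> stays in the box and leaves the
      domain.\<close>
    define t where "t = (x j - l ^ k j / 2 + min (lo j) (x j)) / 2"
    have l: "0 < l ^ k i" for i using \<open>0 < l\<close> by simp
    have t: "t < lo j" "\<bar>t - x j\<bar> < l ^ k j / 2"
      using * l[of j] by (auto simp: t_def min_def abs_if field_simps)
    have "x(j := t) \<in> centered_box d k l x"
      using assms(1) j t l by (auto simp: mem_centered_box mem_domain mem_E)
    then have "x(j := t) \<in> domain d I" using assms(3) by auto
    then have "I j = UNIV \<or> lo j \<le> t" using j by (auto simp: mem_domain)
    with t * show False by auto
  qed
qed (use assms in \<open>auto simp: mem_domain\<close>)

lemma boxes_eq: "boxes d k I = {centered_box d k l x | l x. admissible l x}"
proof -
  have "0 < l" if "admissible l x" for l x using that by (simp add: admissible_def)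
  then have "x \<in> domain d I \<and> 0 < l \<and> centered_box d k l x \<subseteq> domain d I \<longleftrightarrow> admissible l x" for l x
    using subset_admissible admissible_subset admissible_domain by metis
  then show ?thesis by (simp only: boxes_def)
qed

text \<open>The smallest upward translation of a centre that puts its box of size \<open>l\<close>
  inside the domain.\<close>

definition shift :: "real \<Rightarrow> (nat \<Rightarrow> real) \<Rightarrow> nat \<Rightarrow> real" where
  "shift l x j = (if j < d \<and> I j \<noteq> UNIV then max (x j) (lo j + l ^ k j / 2) else x j)"

lemma shift_admissible: "0 < l \<Longrightarrow> x \<in> E \<Longrightarrow> admissible l (shift l x)"
  by (auto simp: admissible_def shift_def mem_E)

lemma shift_id: "admissible l x \<Longrightarrow> shift l x = x"
  by (auto simp: admissible_def shift_def fun_eq_iff)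

lemma shift_shift:
  assumes "0 \<le> l" "l \<le> r" shows "shift r (shift l x) = shift r x"
proof
  fix j
  have "l ^ k j \<le> r ^ k j" using assms by (intro power_mono) auto
  then show "shift r (shift l x) j = shift r x j" by (auto simp: shift_def)
qed

text \<open>In a coordinate that really moves, the new side is the interval from \<open>lo j\<close>
  to \<open>lo j + l ^ k j\<close>. Hence translation loses no point of the old box that lies
  strictly above \<open>lo j\<close>.\<close>

lemma in_shifted_box:
  assumes "v \<in> E" "\<And>j. j < d \<Longrightarrow> I j \<noteq> UNIV \<Longrightarrow> lo j < v j"
    "\<And>j. j < d \<Longrightarrow> \<bar>v j - x j\<bar> < l ^ k j / 2"
  shows "v \<in> centered_box d k l (shift l x)"
  unfolding mem_centered_box
proof (intro conjI allI impI)
  fix j assume "j < d"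
  then show "\<bar>v j - shift l x j\<bar> < l ^ k j / 2"
    using assms(2,3)[of j] by (auto simp: shift_def max_def abs_if split: if_splits)
qed (rule assms)

section \<open>Measurability of boxes and of the domain\<close>

lemma sets_M: "A \<in> sets borel \<Longrightarrow> A \<subseteq> domain d I \<Longrightarrow> A \<in> sets M"
  using doubling by (auto simp: doubling_space_def sets_restrict_space image_iff intro!: bexI[of _ A])

lemma space_M: "space M = domain d I"
  using doubling sets_eq_imp_space_eq[of M "restrict_space borel (domain d I)"]
  by (simp add: doubling_space_def space_restrict_space)

lemma coordinate_measurable [measurable]: "(\<lambda>y::nat \<Rightarrow> real. y j) \<in> borel_measurable borel"
  by (intro borel_measurable_continuous_onI continuous_on_product_coordinates)

lemma E_borel [measurable]: "E \<in> sets borel"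
proof -
  have "E = {x\<in>space borel. \<forall>i. i \<ge> d \<longrightarrow> x i = 0}" by (auto simp: mem_E)
  then show ?thesis by simp
qed

lemma centered_box_borel [measurable]: "centered_box d k l x \<in> sets borel"
proof -
  have "centered_box d k l x = E \<inter> {y\<in>space borel. \<forall>j\<in>{..<d}. \<bar>y j - x j\<bar> < l ^ k j / 2}"
    by (auto simp: mem_centered_box)
  then show ?thesis by simp
qed

lemma corner_box_borel [measurable]: "corner_box d k l x \<in> sets borel"
proof -
  have "corner_box d k l x = E \<inter> {y\<in>space borel. \<forall>j\<in>{..<d}. x j \<le> y j \<and> y j < x j + l ^ k j}"
    by (auto simp: corner_box_def)
  then show ?thesis by simp
qed

lemma domain_borel [measurable]: "domain d I \<in> sets borel"
proof -
  have "domain d I = E \<inter> {y\<in>space borel. \<forall>j\<in>{..<d}. I j = UNIV \<or> lo j \<le> y j}"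
    by (rule set_eqI) (simp add: mem_domain lessThan_def Ball_def)
  then show ?thesis by simp
qed

text \<open>The enlarged box is reached in two steps, because the shifted box of size \<open>4 * l\<close> need not lie in
  \<open>centered_box d k (4 * l) x\<close>, whereas the one of size \<open>2 * l\<close> does.\<close>

lemma emeasure_shift_double:
  assumes "admissible l x"
  shows "emeasure M (centered_box d k (2 * l) (shift (2 * l) x)) \<le> ennreal N\<^sub>0 * emeasure M (centered_box d k l x)"
proof -
  have l: "0 < l" "x \<in> E" using assms by (auto simp: admissible_def)
  have adm: "admissible (2 * l) (shift (2 * l) x)" using l by (intro shift_admissible) auto
  have "\<bar>v j - x j\<bar> < (4 * l) ^ k j / 2"
    if v: "v \<in> centered_box d k (2 * l) (shift (2 * l) x)" and j: "j < d" for v j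
  proof -
    define t u :: real where "t = 2 ^ k j" and "u = l ^ k j"
    have tu: "(2 * l) ^ k j = t * u" "(4 * l) ^ k j = (t * t) * u"
      using power_mult_distrib[of 2 "2 * l" "k j"]
      by (simp_all add: t_def u_def power_mult_distrib)
    have "2 ^ 1 \<le> t" unfolding t_def using k_ge_1[OF j] by (intro power_increasing) auto
    then have "2 \<le> t" by simp
    have "0 < u" using l by (simp add: u_def)
    \<comment> \<open>If coordinate \<open>j\<close> moves, its offset is at most
      \<open>(t - 1) * u / 2\<close>; adding the half side \<open>t * u / 2\<close> must stay within
      \<open>t * t * u / 2\<close>, that is, \<open>2 * t - 1 \<le> t * t\<close>.\<close>
    have "0 \<le> (t - 1)\<^sup>2" by simp
    then have "2 * t - 1 \<le> t * t" by (simp add: power2_eq_square algebra_simps)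
    then have 1: "2 * (t * u) - u \<le> t * t * u"
      using mult_right_mono[of "2 * t - 1" "t * t" u] \<open>0 < u\<close> by (simp add: left_diff_distrib)
    have 2: "t * u \<le> t * t * u" using \<open>0 < u\<close> \<open>2 \<le> t\<close> by (intro mult_right_mono) auto
    have "\<bar>v j - shift (2 * l) x j\<bar> < t * u / 2"
      using v j unfolding tu(1)[symmetric] mem_centered_box by blast
    moreover have "I j \<noteq> UNIV \<longrightarrow> lo j + u / 2 \<le> x j"
      using assms j by (auto simp: admissible_def u_def)
    moreover have "shift (2 * l) x j = x j \<or> I j \<noteq> UNIV \<and>
        shift (2 * l) x j = lo j + t * u / 2 \<and> x j \<le> lo j + t * u / 2"
      using j unfolding shift_def tu(1) by (auto simp: max_def)
    ultimately show ?thesis using 1 2 unfolding tu by linarith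
  qed
  then have "centered_box d k (2 * l) (shift (2 * l) x) \<subseteq> centered_box d k (4 * l) x \<inter> domain d I"
    using admissible_subset[OF adm] mem_centered_box by blast
  moreover have "centered_box d k l x \<in> boxes d k I" using assms boxes_eq by auto
  moreover have "centered_box d k (4 * l) x \<inter> domain d I \<in> sets M"
    by (intro sets_M sets.Int) auto
  ultimately show ?thesis
    using doubling l admissible_domain[OF assms] unfolding doubling_space_def
    by (meson emeasure_mono order_trans)
qed

lemma admissible_sets: "admissible l x \<Longrightarrow> centered_box d k l x \<in> sets M"
  by (intro sets_M admissible_subset) auto

lemma emeasure_shift_4:
  assumes "admissible l x"
  shows "emeasure M (centered_box d k (4 * l) (shift (4 * l) x))
    \<le> (ennreal N\<^sub>0 * ennreal N\<^sub>0) * emeasure M (centered_box d k l x)"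
proof -
  have l: "0 < l" "x \<in> E" using assms by (auto simp: admissible_def)
  then have adm: "admissible (2 * l) (shift (2 * l) x)" by (intro shift_admissible) auto
  have "shift (4 * l) (shift (2 * l) x) = shift (4 * l) x"
    using l by (intro shift_shift) auto
  then have "emeasure M (centered_box d k (4 * l) (shift (4 * l) x))
      \<le> ennreal N\<^sub>0 * emeasure M (centered_box d k (2 * l) (shift (2 * l) x))"
    using emeasure_shift_double[OF adm] by simp
  also have "\<dots> \<le> ennreal N\<^sub>0 * (ennreal N\<^sub>0 * emeasure M (centered_box d k l x))"
    by (intro mult_left_mono emeasure_shift_double assms) simp
  finally show ?thesis by (simp add: mult.assoc)
qed

lemma emeasure_shift_power:
  assumes "admissible l x" "emeasure M (centered_box d k l x) = 0"
  shows "emeasure M (centered_box d k (4 ^ n * l) (shift (4 ^ n * l) x)) = 0"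
proof (induction n)
  case 0
  show ?case using assms by (simp add: shift_id)
next
  case (Suc n)
  have l: "0 < l" "x \<in> E" using assms by (auto simp: admissible_def)
  then have adm: "admissible (4 ^ n * l) (shift (4 ^ n * l) x)" by (intro shift_admissible) auto
  have "shift (4 * (4 ^ n * l)) (shift (4 ^ n * l) x) = shift (4 * (4 ^ n * l)) x"
    using l by (intro shift_shift) auto
  then show ?case
    using emeasure_shift_4[OF adm] Suc by (simp add: mult.assoc)
qed

text \<open>By doubling, a null box would make arbitrarily large boxes around it null, hence all
  corner boxes at \<open>x\<close>, contradicting their divergence to infinity.\<close>

lemma emeasure_box_pos:
  assumes adm: "admissible l x"
  shows "0 < emeasure M (centered_box d k l x)"
proof (rule ccontr)
  assume "\<not> ?thesis"
  then have zero: "emeasure M (centered_box d k l x) = 0" by simp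
  have l: "0 < l" "x \<in> E" using adm by (auto simp: admissible_def)
  have "emeasure M (corner_box d k r x) = 0" if "0 < r" for r
  proof -
    \<comment> \<open>The factor 2 makes \<open>r ^ k j\<close> at most half of
      \<open>L ^ k j\<close>, since \<open>k j\<close> is at least 1.\<close>
    obtain n where n: "2 * r / l < 4 ^ n" using real_arch_pow[of 4 "2 * r / l"] by auto
    define L where "L = 4 ^ n * l"
    have L: "2 * r < L" "0 < L" using n l by (simp_all add: L_def field_simps)
    have "corner_box d k r x \<subseteq> centered_box d k L (shift L x)"
    proof
      fix v assume v: "v \<in> corner_box d k r x"
      show "v \<in> centered_box d k L (shift L x)"
      proof (rule in_shifted_box)
        fix j assume j: "j < d"
        have "(2 * r) ^ k j \<le> L ^ k j" using L that by (intro power_mono) auto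
        moreover have "(2::real) ^ 1 \<le> 2 ^ k j" using k_ge_1[OF j] by (intro power_increasing) auto
        then have "2 * r ^ k j \<le> 2 ^ k j * r ^ k j" using that by (intro mult_right_mono) auto
        ultimately have "r ^ k j \<le> L ^ k j / 2" by (simp add: power_mult_distrib)
        then show "\<bar>v j - x j\<bar> < L ^ k j / 2" using v j by (auto simp: corner_box_def abs_if)
      next
        fix j assume j: "j < d" "I j \<noteq> UNIV"
        then have "lo j + l ^ k j / 2 \<le> x j" using adm by (auto simp: admissible_def)
        moreover have "0 < l ^ k j" using l by simp
        ultimately show "lo j < v j" using v j by (fastforce simp: corner_box_def)
      qed (use v in \<open>auto simp: corner_box_def\<close>)
    qed
    then have "emeasure M (corner_box d k r x) \<le> emeasure M (centered_box d k L (shift L x))"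
      using L l by (intro emeasure_mono admissible_sets shift_admissible) auto
    also have "\<dots> = 0" unfolding L_def by (rule emeasure_shift_power[OF adm zero])
    finally show ?thesis by simp
  qed
  then have "\<forall>\<^sub>F r in at_top. emeasure M (corner_box d k r x) = 0"
    by (intro eventually_mono[OF eventually_gt_at_top[of "0::real"]]) blast
  then have "((\<lambda>r. emeasure M (corner_box d k r x)) \<longlongrightarrow> 0) at_top"
    by (rule tendsto_eventually)
  moreover have "((\<lambda>r. emeasure M (corner_box d k r x)) \<longlongrightarrow> \<infinity>) at_top"
    using doubling admissible_domain[OF adm] by (auto simp: doubling_space_def)
  ultimately have "(0::ennreal) = \<infinity>" by (intro tendsto_unique[of at_top]) auto
  then show False by simp
qed

lemma emeasure_box_finite:
  assumes adm: "admissible l x"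
  shows "emeasure M (centered_box d k l x) < top"
proof -
  \<comment> \<open>The lower corner of the box. Admissibility puts it in the domain, possibly on
    its boundary, so finiteness of corner boxes applies.\<close>
  define z where "z j = (if j < d then x j - l ^ k j / 2 else 0)" for j
  have l: "0 < l" using adm by (auto simp: admissible_def)
  have z: "z \<in> domain d I"
    unfolding mem_domain
  proof (intro conjI allI impI)
    fix j assume "j < d"
    then show "I j = UNIV \<or> lo j \<le> z j" using adm by (force simp: admissible_def z_def)
  qed (simp add: mem_E z_def)
  have "corner_box d k l z \<subseteq> domain d I"
  proof
    fix y assume y: "y \<in> corner_box d k l z"
    then have "z j \<le> y j" if "j < d" for j using that by (simp add: corner_box_def)
    with z y show "y \<in> domain d I"
      by (auto simp: mem_domain corner_box_def intro: order_trans)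
  qed
  moreover have "centered_box d k l x \<subseteq> corner_box d k l z"
    by (auto simp: centered_box_def corner_box_def z_def)
  ultimately have "emeasure M (centered_box d k l x) \<le> emeasure M (corner_box d k l z)"
    by (intro emeasure_mono sets_M) auto
  also have "\<dots> < top" using doubling z l by (auto simp: doubling_space_def)
  finally show ?thesis .
qed

text \<open>Boxes are open only relative to \<open>E\<close>, as their coordinates from
  \<open>d\<close> on are fixed at 0.\<close>

lemma Lindeloef_boxes:
  assumes "\<F> \<subseteq> boxes d k I"
  shows "\<exists>\<C>\<subseteq>\<F>. countable \<C> \<and> \<Union>\<C> = \<Union>\<F>"
proof -
  have "openin (top_of_set E) S" if "S \<in> \<F>" for S
  proof -
    have "S \<in> boxes d k I" using that assms by blast
    then obtain l x where S: "S = centered_box d k l x" unfolding boxes_eq by blast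
    have "S = E \<inter> (\<Inter>j\<in>{..<d}. (\<lambda>y. y j) -` {x j - l ^ k j / 2 <..< x j + l ^ k j / 2})"
      by (auto simp: S centered_box_def)
    moreover have "open (\<Inter>j\<in>{..<d}. (\<lambda>y::nat\<Rightarrow>real. y j) -` {x j - l ^ k j / 2 <..< x j + l ^ k j / 2})"
      by (intro open_INT ballI open_vimage continuous_on_product_coordinates) auto
    ultimately show ?thesis by (auto simp: openin_open)
  qed
  from Lindelof_openin[of \<F> E, OF this] show ?thesis by (metis (no_types))
qed

section \<open>The boundary of the domain\<close>

lemma openin_E: "openin (Euclidean_space d) T \<longleftrightarrow> (\<exists>U. open U \<and> T = E \<inter> U)"
  and closedin_E: "closedin (Euclidean_space d) T \<longleftrightarrow> (\<exists>U. closed U \<and> T = E \<inter> U)"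
  unfolding topspace_Euclidean_space unfolding Euclidean_space_def euclidean_product_topology
  by (auto simp: openin_open closedin_closed)

text \<open>Lowering coordinate \<open>j\<close> slightly leaves the domain while staying in any
  given neighbourhood; the curve \<open>c\<close> makes this precise in the product
  topology.\<close>

lemma frontier_if_lo:
  assumes x: "x \<in> domain d I" and j: "j < d" "I j \<noteq> UNIV" "x j = lo j"
  shows "x \<in> Euclidean_space d frontier_of domain d I"
  unfolding frontier_of_def
proof
  show "x \<in> Euclidean_space d closure_of domain d I"
    using x closure_of_subset[of "domain d I" "Euclidean_space d"] mem_domain by blast
  show "x \<notin> Euclidean_space d interior_of domain d I"
  proof
    assume "x \<in> Euclidean_space d interior_of domain d I"
    then obtain T where T: "openin (Euclidean_space d) T" "x \<in> T" "T \<subseteq> domain d I"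
      by (auto simp: interior_of_def)
    then obtain U where U: "open U" "T = E \<inter> U"
      unfolding openin_E by blast
    define c where "c t = (\<lambda>i. if i = j then t else x i)" for t :: real
    have "continuous_on UNIV (\<lambda>t. c t i)" for i
      by (cases "i = j") (auto simp: c_def)
    then have "continuous_on UNIV c"
      by (rule continuous_on_coordinatewise_then_product)
    then have "open (c -` U)" using U by (intro open_vimage) auto
    moreover have "c (lo j) = x" using j by (auto simp: c_def)
    then have "lo j \<in> c -` U" using T U by auto
    ultimately obtain e where e: "0 < e" "ball (lo j) e \<subseteq> c -` U"
      using open_contains_ball by blast
    have "lo j - e / 2 \<in> ball (lo j) e" using e by (simp add: dist_real_def)
    then have "c (lo j - e / 2) \<in> U" using e(2) by blast
    moreover have "c (lo j - e / 2) \<in> E" using x j by (auto simp: c_def mem_domain mem_E)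
    ultimately have "c (lo j - e / 2) \<in> domain d I" using T U by auto
    then have "lo j \<le> c (lo j - e / 2) j" using j by (auto simp: mem_domain)
    then show False using e by (simp add: c_def)
  qed
qed

text \<open>\<open>emeasure\<close> is 0 on nonmeasurable sets, so the assumption on the boundary
  yields a null set only once the boundary is known to belong to \<open>sets M\<close>;
  \<open>frontier_subset\<close> serves the same end.\<close>

lemma frontier_borel: "Euclidean_space d frontier_of domain d I \<in> sets borel"
proof -
  obtain T where "closed T" "Euclidean_space d frontier_of domain d I = E \<inter> T"
    using closedin_frontier_of[of "Euclidean_space d" "domain d I"] unfolding closedin_E by blast
  then show ?thesis by simp
qed

lemma frontier_subset: "Euclidean_space d frontier_of domain d I \<subseteq> domain d I"
proof (rule frontier_of_subset_closedin)
  let ?J = "{j\<in>{..<d}. I j \<noteq> UNIV}"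
  have "domain d I = E \<inter> (\<Inter>j\<in>?J. (\<lambda>y. y j) -` {lo j..})"
    by (rule set_eqI) (simp add: mem_domain lessThan_def Ball_def, blast)
  moreover have "closed (\<Inter>j\<in>?J. (\<lambda>y::nat\<Rightarrow>real. y j) -` {lo j..})"
    by (intro closed_INT ballI closed_vimage continuous_on_product_coordinates) auto
  ultimately show "closedin (Euclidean_space d) (domain d I)"
    unfolding closedin_E by blast
qed

text \<open>The covering argument needs a size for a set, so one representing length is chosen; only
  the existence of a centre for it is used.\<close>

definition side :: "(nat \<Rightarrow> real) set \<Rightarrow> real" where
  "side Q = (SOME l. \<exists>x. admissible l x \<and> Q = centered_box d k l x)"

lemma side_box:
  assumes "Q \<in> boxes d k I"
  obtains x where "admissible (side Q) x" "Q = centered_box d k (side Q) x"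
proof -
  have "\<exists>l x. admissible l x \<and> Q = centered_box d k l x" using assms by (auto simp: boxes_eq)
  then have "\<exists>x. admissible (side Q) x \<and> Q = centered_box d k (side Q) x"
    unfolding side_def by (rule someI_ex)
  with that show thesis by auto
qed

sublocale doubling_family M "boxes d k I" side "ennreal N\<^sub>0 * ennreal N\<^sub>0"
proof
  fix Q assume "Q \<in> boxes d k I"
  then obtain x where x: "admissible (side Q) x" "Q = centered_box d k (side Q) x"
    by (rule side_box)
  define l where "l = side Q"
  note x = x[folded l_def]
  have l: "0 < l" "x \<in> E" using x by (auto simp: admissible_def)
  show "Q \<in> sets M" "0 < emeasure M Q" "emeasure M Q < top"
    unfolding x(2) by (rule admissible_sets emeasure_box_pos emeasure_box_finite, rule x(1))+
  let ?Q' = "centered_box d k (4 * l) (shift (4 * l) x)"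
  \<comment> \<open>Through a common point \<open>z\<close>, the distance from \<open>v\<close> to
    \<open>x\<close> in coordinate \<open>j\<close> is below three half sides of \<open>Q\<close>,
    and \<open>4 * l\<close> provides at least four.\<close>
  have swallow: "R \<subseteq> ?Q'" if R: "R \<in> boxes d k I" "R \<inter> Q \<noteq> {}" "side R \<le> side Q" for R
  proof
    fix v assume v: "v \<in> R"
    obtain y where y: "admissible (side R) y" "R = centered_box d k (side R) y"
      using R(1) by (rule side_box)
    obtain z where z: "z \<in> R" "z \<in> Q" using R(2) by auto
    show "v \<in> ?Q'"
    proof (rule in_shifted_box)
      fix j assume j: "j < d"
      have "0 < side R" using y by (simp add: admissible_def)
      then have 1: "side R ^ k j \<le> l ^ k j" using R(3) by (intro power_mono) (auto simp: l_def)
      have "(4::real) ^ 1 \<le> 4 ^ k j" using k_ge_1[OF j] by (intro power_increasing) auto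
      then have "4 * l ^ k j \<le> 4 ^ k j * l ^ k j" using l by (intro mult_right_mono) auto
      then have 2: "4 * l ^ k j \<le> (4 * l) ^ k j" by (simp add: power_mult_distrib)
      have 0: "0 < l ^ k j" using l by simp
      have "\<bar>v j - y j\<bar> < side R ^ k j / 2" "\<bar>z j - y j\<bar> < side R ^ k j / 2" "\<bar>z j - x j\<bar> < l ^ k j / 2"
        using v z j x(2) y(2) mem_centered_box by blast+
      then show "\<bar>v j - x j\<bar> < (4 * l) ^ k j / 2" using 0 1 2 by linarith
    next
      show "lo j < v j" if "j < d" "I j \<noteq> UNIV" for j
        using interior_if_in_admissible[OF y(1) _ that] v y(2) by auto
    qed (use v y(2) mem_centered_box in blast)
  qed
  have "?Q' \<in> boxes d k I"
    using shift_admissible[of "4 * l" x] l by (auto simp: boxes_eq)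
  moreover have "emeasure M ?Q' \<le> ennreal N\<^sub>0 * ennreal N\<^sub>0 * emeasure M Q"
    using emeasure_shift_4[OF x(1)] by (simp add: x(2))
  moreover have "Q \<subseteq> ?Q'"
  proof (cases "Q = {}")
    case False
    then show ?thesis using swallow[of Q] \<open>Q \<in> boxes d k I\<close> by auto
  qed auto
  ultimately show "\<exists>Q'\<in>boxes d k I. Q \<subseteq> Q' \<and> emeasure M Q' \<le> ennreal N\<^sub>0 * ennreal N\<^sub>0 * emeasure M Q \<and>
      (\<forall>R\<in>boxes d k I. R \<inter> Q \<noteq> {} \<longrightarrow> side R \<le> side Q \<longrightarrow> R \<subseteq> Q')"
    using swallow by blast
next
  show "\<exists>\<C>\<subseteq>\<F>. countable \<C> \<and> \<Union>\<C> = \<Union>\<F>" if "\<F> \<subseteq> boxes d k I" for \<F>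
    using that by (rule Lindeloef_boxes)
  show "ennreal N\<^sub>0 * ennreal N\<^sub>0 < top" by (simp add: ennreal_mult_less_top)
next
  fix P Q assume "P \<in> boxes d k I" "Q \<in> boxes d k I"
  then obtain l x r y where P: "admissible l x" "P = centered_box d k l x"
    and Q: "admissible r y" "Q = centered_box d k r y"
    by (auto simp: boxes_eq)
  have lr: "0 < l" "0 < r" "x \<in> E" using P Q by (auto simp: admissible_def)
  \<comment> \<open>The sum dominates the requirement of every coordinate at once, and
    \<open>1 \<le> L\<close> ensures that \<open>L ^ k j\<close> is at least
    \<open>L\<close>.\<close>
  define S where "S = (\<Sum>j<d. 2 * \<bar>y j - x j\<bar> + r ^ k j)"
  have S: "2 * \<bar>y j - x j\<bar> + r ^ k j \<le> S" if "j < d" for j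
    unfolding S_def using lr that by (auto intro!: member_le_sum)
  define L where "L = 1 + l + max 0 S"
  have L: "1 \<le> L" "l \<le> L" using lr by (auto simp: L_def)
  let ?R = "centered_box d k L (shift L x)"
  have R: "?R \<in> boxes d k I" using shift_admissible[of L x] L lr by (auto simp: boxes_eq)
  have "P \<subseteq> ?R"
  proof
    fix v assume v: "v \<in> P"
    show "v \<in> ?R"
    proof (rule in_shifted_box)
      fix j assume j: "j < d"
      have "l ^ k j \<le> L ^ k j" using L lr by (intro power_mono) auto
      then show "\<bar>v j - x j\<bar> < L ^ k j / 2" using v j P(2) by (auto simp: mem_centered_box)
    next
      show "lo j < v j" if "j < d" "I j \<noteq> UNIV" for j
        using interior_if_in_admissible[OF P(1) _ that] v P(2) by auto
    qed (use v P(2) mem_centered_box in blast)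
  qed
  moreover have "Q \<subseteq> ?R"
  proof
    fix v assume v: "v \<in> Q"
    show "v \<in> ?R"
    proof (rule in_shifted_box)
      fix j assume j: "j < d"
      have "L ^ 1 \<le> L ^ k j" using L k_ge_1[OF j] by (intro power_increasing) auto
      then have "L \<le> L ^ k j" by simp
      moreover have "S < L" using lr by (simp add: L_def)
      moreover have "\<bar>v j - y j\<bar> < r ^ k j / 2" using v j Q(2) by (simp add: mem_centered_box)
      moreover have "\<bar>v j - x j\<bar> \<le> \<bar>v j - y j\<bar> + \<bar>y j - x j\<bar>"
        using abs_triangle_ineq[of "v j - y j" "y j - x j"] by simp
      moreover note S[OF j]
      ultimately show "\<bar>v j - x j\<bar> < L ^ k j / 2" by argo
    next
      show "lo j < v j" if "j < d" "I j \<noteq> UNIV" for j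
        using interior_if_in_admissible[OF Q(1) _ that] v Q(2) by auto
    qed (use v Q(2) mem_centered_box in blast)
  qed
  ultimately show "\<exists>R\<in>boxes d k I. P \<subseteq> R \<and> Q \<subseteq> R" using R by blast
next
  \<comment> \<open>Off the boundary every coordinate lies strictly above \<open>lo j\<close>, so
    the translated unit box contains the point.\<close>
  have inner: "x \<in> \<Union>(boxes d k I)" if x: "x \<in> domain d I" "x \<notin> Euclidean_space d frontier_of domain d I" for x
  proof -
    have "x \<in> centered_box d k 1 (shift 1 x)"
      using x frontier_if_lo[of x] by (intro in_shifted_box) (force simp: mem_domain)+
    moreover have "centered_box d k 1 (shift 1 x) \<in> boxes d k I"
      using shift_admissible[of 1 x] x by (auto simp: boxes_eq mem_domain)
    ultimately show ?thesis by blast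
  qed
  have "Euclidean_space d frontier_of domain d I \<in> null_sets M"
    using doubling sets_M[OF frontier_borel frontier_subset]
    by (auto simp: doubling_space_def intro!: null_setsI)
  then have "AE x in M. x \<notin> Euclidean_space d frontier_of domain d I"
    by (rule AE_not_in)
  with AE_space show "AE x in M. x \<in> \<Union>(boxes d k I)"
    by eventually_elim (use inner space_M in auto)
next
  have "shift_admissible": "admissible 1 (shift 1 (\<lambda>_. 0))" by (intro shift_admissible) (auto simp: mem_E)
  then show "boxes d k I \<noteq> {}" by (auto simp: boxes_eq)
qed

end

theorem theorem6p1:
  fixes p q K\<^sub>q N\<^sub>0 :: real
  assumes "1 < p" and "1 < q" and "1 < K\<^sub>q"
  shows "\<exists>K\<^sub>p\<ge>1. \<forall>d k I M f g.
    doubling_space d k I M N\<^sub>0 \<longrightarrow>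
    f \<in> borel_measurable M \<longrightarrow> (\<forall>x\<in>domain d I. 0 \<le> f x) \<longrightarrow>
    g \<in> borel_measurable M \<longrightarrow> (\<forall>x\<in>domain d I. 0 \<le> g x) \<longrightarrow>
    (\<forall>w\<^sub>p \<in> Ap_weights M (boxes d k I) p. Ap_const M (boxes d k I) p w\<^sub>p \<le> K\<^sub>p \<longrightarrow>
       (\<integral>\<^sup>+x. ennreal (f x powr p) * w\<^sub>p x \<partial>M) \<le> (\<integral>\<^sup>+x. ennreal (g x powr p) * w\<^sub>p x \<partial>M)) \<longrightarrow>
    (\<forall>w\<^sub>q \<in> Ap_weights M (boxes d k I) q. Ap_const M (boxes d k I) q w\<^sub>q \<le> K\<^sub>q \<longrightarrow>
       (\<integral>\<^sup>+x. ennreal (f x powr q) * w\<^sub>q x \<partial>M)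
         \<le> ennreal (4 powr q) * (\<integral>\<^sup>+x. ennreal (g x powr q) * w\<^sub>q x \<partial>M))"
proof -
  \<comment> \<open>All constants are fixed before \<open>d\<close>, \<open>k\<close>,
    \<open>I\<close>, \<open>M\<close>, \<open>f\<close>, \<open>g\<close> are introduced.
    \<open>N\<close> is a square because a fourfold enlargement consists of two doublings.\<close>
  define N :: ennreal where "N = ennreal N\<^sub>0 * ennreal N\<^sub>0"
  define a b where "a = Muckenhoupt_const q (ennreal K\<^sub>q) N"
    and "b = Muckenhoupt_const (q / (q - 1)) (ennreal K\<^sub>q powe (1 / (q - 1))) N"
  \<comment> \<open>Adding 1 secures \<open>1 \<le> A\<close> and \<open>1 \<le> B\<close>, as the
    iteration requires.\<close>
  define A B where "A = 1 + enn2real a" and "B = 1 + enn2real b"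
  \<comment> \<open>\<open>2 * A\<close> and \<open>2 * B\<close> are the A_1-constants of the
    majorants; \<open>reverse_factorization\<close> turns them into this A_p-constant.\<close>
  define K\<^sub>p where "K\<^sub>p = (2 * A) powr (p - 1) * (2 * B)"
  have AB: "1 \<le> A" "1 \<le> B" by (simp_all add: A_def B_def)
  have "N < top" by (simp add: N_def ennreal_mult_less_top)
  moreover have "1 < q / (q - 1)" using assms by (simp add: field_simps)
  ultimately have ab: "a < top" "b < top"
    unfolding a_def b_def using assms
    by (auto intro!: Muckenhoupt_const_finite simp: powe_less_top_iff)
  have A: "a \<le> ennreal A" and B: "b \<le> ennreal B"
    using ab ennreal_leI[of "enn2real a" A] ennreal_leI[of "enn2real b" B]
    by (simp_all add: A_def B_def)
  have "1 \<le> (2 * A) powr (p - 1)" using AB assms by (intro ge_one_powr_ge_zero) auto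
  then have "1 * 1 \<le> K\<^sub>p" unfolding K\<^sub>p_def using AB by (intro mult_mono) auto
  then have "1 \<le> K\<^sub>p" by simp
  then show ?thesis
  proof (intro exI[of _ K\<^sub>p] conjI allI impI ballI)
    fix d k I M and f g :: "(nat \<Rightarrow> real) \<Rightarrow> real" and w\<^sub>q
    assume doubling: "doubling_space d k I M N\<^sub>0"
      and f [measurable]: "f \<in> borel_measurable M" and f_nonneg: "\<forall>x\<in>domain d I. 0 \<le> f x"
      and g [measurable]: "g \<in> borel_measurable M" and g_nonneg: "\<forall>x\<in>domain d I. 0 \<le> g x"
      and hyp: "\<forall>w\<^sub>p \<in> Ap_weights M (boxes d k I) p. Ap_const M (boxes d k I) p w\<^sub>p \<le> K\<^sub>p \<longrightarrow>
       (\<integral>\<^sup>+x. ennreal (f x powr p) * w\<^sub>p x \<partial>M) \<le> (\<integral>\<^sup>+x. ennreal (g x powr p) * w\<^sub>p x \<partial>M)"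
      and w\<^sub>q: "w\<^sub>q \<in> Ap_weights M (boxes d k I) q" "Ap_const M (boxes d k I) q w\<^sub>q \<le> K\<^sub>q"
    interpret box_space d k I M N\<^sub>0 by unfold_locales (rule doubling)
    have w: "weight M (boxes d k I) w\<^sub>q" "Ap_bound M (boxes d k I) q w\<^sub>q K\<^sub>q"
      using Ap_bound_if_const_le[OF w\<^sub>q] assms by auto
    interpret W: weight_pair M "boxes d k I" side N w\<^sub>q "\<lambda>x. w\<^sub>q x powe (- 1 / (q - 1))" q "ennreal K\<^sub>q"
      unfolding N_def using weight_pairI[OF w] assms by simp
    \<comment> \<open>Real powers agree with \<open>powe\<close> at nonnegative arguments, and
      nonnegativity on the domain suffices because the domain is \<open>space M\<close>.\<close>
    have powr_eq: "(\<integral>\<^sup>+x. ennreal (h x powr r) * v x \<partial>M) = (\<integral>\<^sup>+x. ennreal (h x) powe r * v x \<partial>M)"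
      if "\<forall>x\<in>domain d I. 0 \<le> h x" "0 < r" for h v r
      using that by (intro nn_integral_cong) (simp add: space_M powe_ennreal_nonneg)
    have "(\<integral>\<^sup>+x. ennreal (f x) powe q * w\<^sub>q x \<partial>M) \<le> ennreal (4 powr q) * (\<integral>\<^sup>+x. ennreal (g x) powe q * w\<^sub>q x \<partial>M)"
    proof (rule W.extrapolation[of _ _ A B p])
      fix v assume v: "weight M (boxes d k I) v"
        "Ap_bound M (boxes d k I) p v ((2 * A) powr (p - 1) * (2 * B))"
      then have "v \<in> Ap_weights M (boxes d k I) p" "Ap_const M (boxes d k I) p v \<le> K\<^sub>p"
        unfolding K\<^sub>p_def using Ap_const_le assms by auto
      then show "(\<integral>\<^sup>+x. ennreal (f x) powe p * v x \<partial>M) \<le> (\<integral>\<^sup>+x. ennreal (g x) powe p * v x \<partial>M)"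
        using hyp f_nonneg g_nonneg assms by (simp add: powr_eq)
    qed (use AB A B assms in \<open>auto simp: a_def b_def\<close>)
    then show "(\<integral>\<^sup>+x. ennreal (f x powr q) * w\<^sub>q x \<partial>M)
         \<le> ennreal (4 powr q) * (\<integral>\<^sup>+x. ennreal (g x powr q) * w\<^sub>q x \<partial>M)"
      using f_nonneg g_nonneg assms by (simp add: powr_eq)
  qed
qed

end
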